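(* Let $\mathfrak{A}$ be a unital complex Jordan--Banach algebra with unit $\mathbf{1}$, let $r>0$, let $\mathbb{D}_r=\{z\in\mathbb{C}:|z|<r\}$, and let $f\colon \mathbb{D}_r\to \mathfrak{A}$ be a holomorphic mapping such that $f(0)=\mathbf{1}$. Suppose $(\lambda_n)$ is a sequence in $\mathbb{D}_r$ with $\lim_{n\to\infty}\lambda_n=0$, and $(\mu_n)$ is a sequence in $\mathbb{C}$ such that $\lim_{n\to\infty}\lambda_n\mu_n=\lambda\in\mathbb{C}$. Then for each sufficiently large $n\in\mathbb{N}$, $\bigl(f(\lambda_n)\bigr)^{\mu_n}$ is well-defined, and $$\lim_{n\to\infty}\bigl(f(\lambda_n)\bigr)^{\mu_n}=\exp\bigl(\lambda f'(0)\bigr).$$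
   Context: A complex Jordan--Banach algebra is a complex Banach space $\mathfrak{A}$ with a bilinear product $(a,b)\mapsto a\circ b$ satisfying $\|a\circ b\|\le\|a\|\,\|b\|$, $a\circ b=b\circ a$, and $(a^2\circ b)\circ a=(a\circ b)\circ a^2$ for all $a,b$ (where $a^2=a\circ a$). It is unital if there is $\mathbf{1}\in\mathfrak{A}$ with $\mathbf{1}\circ a=a$ for all $a$. Powers are $a^0=\mathbf{1}$, $a^{n+1}=a\circ a^n$; the closed Jordan subalgebra generated by one element and $\mathbf{1}$ is an associative commutative Banach algebra. The exponential is $\exp(a)=e^a=\sum_{n\ge 0}a^n/n!$. An element $a$ is invertible if there is $b\in\mathfrak{A}$ with $a\circ b=\mathbf{1}$ and $a^2\circ b=a$. The (Jordan-)spectrum of $a$ is $\text{J-}\sigma(a)=\{\lambda\in\mathbb{C}: a-\lambda\mathbf{1}\text{ is not invertible}\}$. For $a\in\mathfrak{A}$ with $\text{J-}\sigma(a)\subset\mathbb{C}\setminus(-\infty,0]$, $\log(a)$ is defined by the holomorphic functional calculus using the principal branch of the logarithm, and for $\mu\in\mathbb{C}$ one sets $a^{\mu}=\exp(\mu\log(a))$; this is what "well-defined" refers to. A mapping $f$ from an open set $\Omega\subseteq\mathbb{C}$ to a complex Banach space is holomorphic if $\lim_{\lambda\to\lambda_0}\frac{f(\lambda)-f(\lambda_0)}{\lambda-\lambda_0}$ exists in norm for every $\lambda_0\in\Omega$; the limit is $f'(\lambda_0)$. *)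

theory Defs
  imports "HOL-Complex_Analysis.Complex_Analysis"
begin

text \<open>The underlying real Banach space structure is the library's; the complex scalar
  multiplication extends the real one.\<close>

class complex_banach = banach +
  fixes scaleC :: "complex \<Rightarrow> 'a \<Rightarrow> 'a"  (infixr \<open>*\<^sub>C\<close> 75)
  assumes scaleR_scaleC: "r *\<^sub>R x = complex_of_real r *\<^sub>C x"
    and scaleC_add_right: "c *\<^sub>C (x + y) = c *\<^sub>C x + c *\<^sub>C y"
    and scaleC_add_left: "(c + d) *\<^sub>C x = c *\<^sub>C x + d *\<^sub>C x"
    and scaleC_scaleC: "c *\<^sub>C d *\<^sub>C x = (c * d) *\<^sub>C x"
    and scaleC_one: "1 *\<^sub>C x = x"
    and norm_scaleC: "norm (c *\<^sub>C x) = cmod c * norm x"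

text \<open>Linearity in the second argument follows from commutativity.\<close>

class jordan_banach_algebra = complex_banach +
  fixes jprod :: "'a \<Rightarrow> 'a \<Rightarrow> 'a"  (infixl \<open>\<odot>\<close> 70)
  assumes jprod_add_left: "(a + b) \<odot> c = a \<odot> c + b \<odot> c"
    and jprod_scaleC_left: "(k *\<^sub>C a) \<odot> b = k *\<^sub>C (a \<odot> b)"
    and jprod_commute: "a \<odot> b = b \<odot> a"
    and jordan_identity: "((a \<odot> a) \<odot> b) \<odot> a = (a \<odot> b) \<odot> (a \<odot> a)"
    and norm_jprod_le: "norm (a \<odot> b) \<le> norm a * norm b"

text \<open>Neither \<open>1 \<noteq> 0\<close> nor \<open>norm 1 = 1\<close> is required.\<close>

class unital_jordan_banach_algebra = jordan_banach_algebra + one +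
  assumes jprod_one_left: "1 \<odot> a = a"

primrec jpow :: "'a::unital_jordan_banach_algebra \<Rightarrow> nat \<Rightarrow> 'a" where
  "jpow a 0 = 1"
| "jpow a (Suc n) = a \<odot> jpow a n"

definition jexp :: "'a::unital_jordan_banach_algebra \<Rightarrow> 'a" where
  "jexp a = (\<Sum>n. jpow a n /\<^sub>R fact n)"

definition is_jinverse :: "'a::unital_jordan_banach_algebra \<Rightarrow> 'a \<Rightarrow> bool" where
  "is_jinverse a b \<longleftrightarrow> a \<odot> b = 1 \<and> (a \<odot> a) \<odot> b = a"

definition jinvertible :: "'a::unital_jordan_banach_algebra \<Rightarrow> bool" where
  "jinvertible a \<longleftrightarrow> (\<exists>b. is_jinverse a b)"

text \<open>The Jordan inverse of an invertible element is unique.\<close>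

definition jinverse :: "'a::unital_jordan_banach_algebra \<Rightarrow> 'a" where
  "jinverse a = (THE b. is_jinverse a b)"

definition jspectrum :: "'a::unital_jordan_banach_algebra \<Rightarrow> complex set" where
  "jspectrum a = {z. \<not> jinvertible (a - z *\<^sub>C 1)}"

text \<open>The holomorphic functional calculus for the principal logarithm \<^const>\<open>Ln\<close> on the slit
  plane: \<open>log a\<close> is the Cauchy integral of \<open>Ln z *\<^sub>C (z 1 - a)\<^sup>-\<^sup>1\<close> over a contour in the slit plane
  around the spectrum. The slit plane is simply connected, so a single closed path suffices
  (no cycles are needed), and its winding number about points of the slit is automatically 0.
  By Cauchy's theorem the integral does not depend on the contour chosen. The path integral is
  written out because \<^const>\<open>contour_integral\<close> is restricted to complex-valued integrands.\<close>

definition log_contour :: "'a::unital_jordan_banach_algebra \<Rightarrow> (real \<Rightarrow> complex) \<Rightarrow> bool" where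
  "log_contour a g \<longleftrightarrow>
     valid_path g \<and> pathfinish g = pathstart g \<and>
     path_image g \<subseteq> - \<real>\<^sub>\<le>\<^sub>0 - jspectrum a \<and>
     (\<forall>z\<in>jspectrum a. winding_number g z = 1)"

definition vcontour_integral :: "(real \<Rightarrow> complex) \<Rightarrow> (complex \<Rightarrow> 'a::complex_banach) \<Rightarrow> 'a" where
  "vcontour_integral g F =
     integral {0..1} (\<lambda>t. vector_derivative g (at t within {0..1}) *\<^sub>C F (g t))"

definition jlog :: "'a::unital_jordan_banach_algebra \<Rightarrow> 'a" where
  "jlog a = (1 / (2 * of_real pi * \<i>)) *\<^sub>C
     vcontour_integral (SOME g. log_contour a g) (\<lambda>z. Ln z *\<^sub>C jinverse (z *\<^sub>C 1 - a))"

definition jpowr_defined :: "'a::unital_jordan_banach_algebra \<Rightarrow> bool" where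
  "jpowr_defined a \<longleftrightarrow> jspectrum a \<subseteq> - \<real>\<^sub>\<le>\<^sub>0"

definition jpowr :: "'a::unital_jordan_banach_algebra \<Rightarrow> complex \<Rightarrow> 'a" where
  "jpowr a \<mu> = jexp (\<mu> *\<^sub>C jlog a)"

definition has_cderiv :: "(complex \<Rightarrow> 'a::complex_banach) \<Rightarrow> 'a \<Rightarrow> complex \<Rightarrow> bool" where
  "has_cderiv f D z0 \<longleftrightarrow> ((\<lambda>z. (1 / (z - z0)) *\<^sub>C (f z - f z0)) \<longlongrightarrow> D) (at z0)"

text \<open>Meant for open \<open>\<Omega>\<close> only: the limit is taken over a full punctured neighbourhood.\<close>

definition vholomorphic_on :: "(complex \<Rightarrow> 'a::complex_banach) \<Rightarrow> complex set \<Rightarrow> bool" where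
  "vholomorphic_on f \<Omega> \<longleftrightarrow> (\<forall>z0\<in>\<Omega>. \<exists>D. has_cderiv f D z0)"

definition cderiv :: "(complex \<Rightarrow> 'a::complex_banach) \<Rightarrow> complex \<Rightarrow> 'a" where
  "cderiv f z0 = (THE D. has_cderiv f D z0)"

end

theory Submission imports Defs begin

text \<open>
  If \<open>c\<close> and \<open>d\<close> are Jordan inverse, then their multiplication operators commute, so inverses are
  unique and the Neumann series in powers of \<open>d\<close> inverts small perturbations of \<open>c\<close>. The resolvent
  is therefore analytic off the spectrum. Testing with functionals provided by Hahn--Banach, Cauchy's
  theorem deforms any admissible contour into a fixed circle about \<open>1\<close>, which gives
  \<open>log a = (a - 1) + O(\<parallel>a - 1\<parallel>\<^sup>2)\<close> near \<open>1\<close>. Since \<open>f z - 1 = z f'(0) + o(z)\<close>, it follows that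
  \<open>\<mu>\<^sub>n log (f \<lambda>\<^sub>n)\<close> tends to \<open>\<lambda> f'(0)\<close>, and the exponential is continuous.
\<close>

section \<open>Jordan inverses\<close>

text \<open>The obstacle is the lack of associativity: multiplication by an invertible element may
  have a kernel, so the resolvent is not an inverse operator, and all its properties have to come
  from the two equations of \<open>is_jinverse\<close>. Below, L(a) denotes multiplication by a. A
  second difficulty is that \<open>jlog\<close> integrates over a contour of which only
  admissibility is known; it may run through the disc that contains the spectrum. Functionals reduce
  the comparison of contours to scalar integrals, but only once the Banach-valued integral is known
  to exist. The order of the estimate matters: the exponents may be unbounded, so an error of first
  order in \<open>a - 1\<close> would survive multiplication by them. An error of second order
  splits into a factor that stays bounded after this multiplication and another that tends to
  0.\<close>

lemma bounded_bilinear_scaleC: "bounded_bilinear (\<lambda>c (x::'a::complex_banach). c *\<^sub>C x)"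
proof
  show "\<exists>K. \<forall>a (b::'a). norm (a *\<^sub>C b) \<le> norm a * norm b * K"
    by (rule exI[of _ 1]) (simp add: norm_scaleC)
  show "(r *\<^sub>R a) *\<^sub>C b = r *\<^sub>R a *\<^sub>C b" for r a and b :: 'a
    by (simp add: scaleR_scaleC scaleC_scaleC scaleR_conv_of_real)
  show "a *\<^sub>C r *\<^sub>R b = r *\<^sub>R a *\<^sub>C b" for r a and b :: 'a
    by (simp add: scaleR_scaleC scaleC_scaleC mult.commute)
qed (simp_all add: scaleC_add_left scaleC_add_right)

interpretation scaleC: bounded_bilinear "\<lambda>c (x::'a::complex_banach). c *\<^sub>C x"
  by (rule bounded_bilinear_scaleC)

declare scaleC.zero_left [simp] scaleC.zero_right [simp]

lemma jprod_add_right: "a \<odot> (b + c) = a \<odot> b + a \<odot> (c::'a::jordan_banach_algebra)"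
  by (metis jprod_add_left jprod_commute)

lemma jprod_scaleC_right: "a \<odot> (k *\<^sub>C b) = k *\<^sub>C (a \<odot> (b::'a::jordan_banach_algebra))"
  by (metis jprod_scaleC_left jprod_commute)

lemma bounded_bilinear_jprod: "bounded_bilinear ((\<odot>) :: 'a::jordan_banach_algebra \<Rightarrow> 'a \<Rightarrow> 'a)"
proof
  show "\<exists>K. \<forall>a (b::'a). norm (a \<odot> b) \<le> norm a * norm b * K"
    by (rule exI[of _ 1]) (simp add: norm_jprod_le)
qed (simp_all add: jprod_add_left jprod_add_right scaleR_scaleC jprod_scaleC_left jprod_scaleC_right)

interpretation jprod: bounded_bilinear "(\<odot>) :: 'a::jordan_banach_algebra \<Rightarrow> 'a \<Rightarrow> 'a"
  by (rule bounded_bilinear_jprod)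

lemmas jprod_linear_simps = jprod.add_left jprod.add_right jprod.diff_left jprod.diff_right
  jprod.minus_left jprod.minus_right jprod.zero_left jprod.zero_right

lemma jprod_one_right: "a \<odot> 1 = (a::'a::unital_jordan_banach_algebra)"
  by (metis jprod_one_left jprod_commute)

section \<open>Polarization of the Jordan identity\<close>

lemma double_eq_0D: "x + x = 0 \<Longrightarrow> x = (0::'a::real_vector)"
  by (metis scaleR_2 scaleR_eq_0_iff zero_neq_numeral)

text \<open>For fixed \<open>b\<close> the Jordan identity is cubic in its other variable. The form
  \<open>G\<close> is its polarization: symmetric and additive in each argument, and zero on the
  diagonal, hence zero everywhere.\<close>

lemma jordan_linearized:
  fixes x y z b :: "'a::jordan_banach_algebra"
  shows "((x \<odot> z) \<odot> b) \<odot> y + ((z \<odot> y) \<odot> b) \<odot> x + ((y \<odot> x) \<odot> b) \<odot> z =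
         (x \<odot> z) \<odot> (b \<odot> y) + (z \<odot> y) \<odot> (b \<odot> x) + (y \<odot> x) \<odot> (b \<odot> z)"
proof -
  define G where "G x y z = ((x \<odot> z) \<odot> b) \<odot> y + ((z \<odot> y) \<odot> b) \<odot> x + ((y \<odot> x) \<odot> b) \<odot> z -
         ((x \<odot> z) \<odot> (b \<odot> y) + (z \<odot> y) \<odot> (b \<odot> x) + (y \<odot> x) \<odot> (b \<odot> z))" for x y z
  have add1: "G (x + x') y z = G x y z + G x' y z" for x x' y z
    by (simp add: G_def jprod_linear_simps algebra_simps)
  have neg1: "G (- x) y z = - G x y z" for x y z
    by (simp add: G_def jprod_linear_simps algebra_simps)
  have sym1: "G x y z = G y x z" for x y z
    by (simp add: G_def jprod_commute[of x z] jprod_commute[of y z] jprod_commute[of x y])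
  have sym2: "G x y z = G x z y" for x y z
    by (simp add: G_def jprod_commute[of x z] jprod_commute[of y z] jprod_commute[of x y])
  have add2: "G x (y + y') z = G x y z + G x y' z" for x y y' z
    by (metis add1 sym1)
  have add3: "G x y (z + z') = G x y z + G x y z'" for x y z z'
    by (metis add2 sym2)
  have neg2: "G x (- y) z = - G x y z" for x y z
    by (metis neg1 sym1)
  have neg3: "G x y (- z) = - G x y z" for x y z
    by (metis neg2 sym2)
  have diag: "G x x x = 0" for x
    using jordan_identity[of x b] by (simp add: G_def jprod_commute[of b x] jprod_commute[of "x \<odot> b" "x \<odot> x"])
  have eq: "3 *\<^sub>R G x x y + 3 *\<^sub>R G x y y = 0" for x y
  proof -
    have "G (x + y) (x + y) (x + y) = G x x x + G x x y + G x x y + G x x y + G x y y + G x y y + G x y y + G y y y"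
      by (simp add: add1 add2 add3 sym1[of y x] sym2[of x y x] sym2[of y y x] algebra_simps)
    then show ?thesis
      by (simp add: diag scaleR_add_left[of 1 2, simplified] scaleR_2 algebra_simps)
  qed
  \<comment> \<open>Replacing \<open>y\<close> by \<open>-y\<close> changes the sign of the part
    linear in \<open>y\<close> only, which separates the two terms of \<open>eq\<close>.\<close>
  have two: "G x x y = 0" for x y
  proof -
    have "3 *\<^sub>R G x y y = 3 *\<^sub>R G x x y"
      using eq[of x "-y"] by (simp add: neg2 neg3)
    then have "3 *\<^sub>R (G x x y + G x x y) = 0"
      using eq[of x y] by (simp add: scaleR_add_right)
    then show ?thesis
      using double_eq_0D by simp
  qed
  have "G (x + y) (x + y) z = G x x z + G y y z + (G x y z + G x y z)"
    by (simp add: add1 add2 sym1[of y x] algebra_simps)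
  then have "G x y z = 0"
    using double_eq_0D by (simp add: two)
  then show ?thesis
    by (simp add: G_def)
qed

text \<open>The same identity arranged as a relation between multiplication operators applied to
  \<open>z\<close>: the products of three operators and one single operator on the left become
  products of two.\<close>

lemma jordan_linearized_op:
  fixes x y z b :: "'a::jordan_banach_algebra"
  shows "y \<odot> (b \<odot> (x \<odot> z)) + x \<odot> (b \<odot> (y \<odot> z)) + ((x \<odot> y) \<odot> b) \<odot> z =
         (b \<odot> y) \<odot> (x \<odot> z) + (b \<odot> x) \<odot> (y \<odot> z) + (x \<odot> y) \<odot> (b \<odot> z)"
  using jordan_linearized[of x z b y] by (simp add: jprod_commute algebra_simps)

text \<open>The commutator of two multiplication operators. It is a derivation, which is what forces it to
  vanish when the two elements are inverse to each other.\<close>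

definition jcomm :: "'a::jordan_banach_algebra \<Rightarrow> 'a \<Rightarrow> 'a \<Rightarrow> 'a" where
  "jcomm a b x = a \<odot> (b \<odot> x) - b \<odot> (a \<odot> x)"

lemma jcomm_swap: "jcomm a b x = - jcomm b a x"
  by (simp add: jcomm_def)

lemma jcomm_zero [simp]: "jcomm a b 0 = 0"
  by (simp add: jcomm_def jprod_linear_simps)

lemma jcomm_add: "jcomm a b (x + y) = jcomm a b x + jcomm a b y"
  by (simp add: jcomm_def jprod_linear_simps)

text \<open>In \<open>jordan_linearized_op\<close> with \<open>x\<close> and one of
  \<open>a\<close>, \<open>b\<close> as outer factors and the other in the middle, the right-hand
  side is symmetric in \<open>a\<close> and \<open>b\<close>. Subtracting the two instances leaves
  the product rule.\<close>

lemma jcomm_derivation: "jcomm a b (x \<odot> y) = jcomm a b x \<odot> y + x \<odot> jcomm a b y"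
proof -
  have 1: "x \<odot> (b \<odot> (a \<odot> y)) + a \<odot> (b \<odot> (x \<odot> y)) + ((a \<odot> x) \<odot> b) \<odot> y =
     x \<odot> (a \<odot> (b \<odot> y)) + b \<odot> (a \<odot> (x \<odot> y)) + ((b \<odot> x) \<odot> a) \<odot> y"
    using jordan_linearized_op[of x b a y] jordan_linearized_op[of x a b y]
    by (simp add: jprod_commute[of b a] jprod_commute[of a x] jprod_commute[of b x] algebra_simps)
  have 2: "(a \<odot> x) \<odot> b = b \<odot> (a \<odot> x)" "(b \<odot> x) \<odot> a = a \<odot> (b \<odot> x)"
    by (rule jprod_commute)+
  show ?thesis
    using 1 unfolding jcomm_def 2 by (simp add: jprod_linear_simps algebra_simps)
qed

lemma jprod_square_commute: "a \<odot> ((a \<odot> a) \<odot> x) = (a \<odot> a) \<odot> (a \<odot> (x::'a::jordan_banach_algebra))"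
  using jordan_identity[of a x] by (metis jprod_commute)

section \<open>Identities for an inverse pair\<close>

context
  fixes c d :: "'a::unital_jordan_banach_algebra"
  assumes inv: "is_jinverse c d"
begin

lemma jinv_simps: "c \<odot> d = 1" "d \<odot> c = 1" "(c \<odot> c) \<odot> d = c" "d \<odot> (c \<odot> c) = c"
  using inv jprod_commute unfolding is_jinverse_def by metis+

text \<open>Polarize at \<open>c\<close>, \<open>c\<close>, \<open>d\<close>: since
  \<open>c \<odot> d = 1\<close>, the terms without the square of \<open>c\<close> cancel in
  pairs.\<close>

lemma jinv_sq_commute: "d \<odot> ((c \<odot> c) \<odot> x) = (c \<odot> c) \<odot> (d \<odot> x)"
  using jordan_linearized[of c c x d]
  by (simp add: jinv_simps jprod_one_left) (metis jinv_simps(1,2) add.commute add_right_cancel jprod_commute jprod_one_left)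

lemma jinv_LcLdLc: "c \<odot> (d \<odot> (c \<odot> x)) + c \<odot> (d \<odot> (c \<odot> x)) = c \<odot> x + (c \<odot> c) \<odot> (d \<odot> x)"
  using jordan_linearized_op[of c d c x] by (simp add: jinv_simps jprod_one_left algebra_simps)

lemma jinv_LcLcLd: "c \<odot> (c \<odot> (d \<odot> x)) + d \<odot> (c \<odot> (c \<odot> x)) = (c \<odot> c) \<odot> (d \<odot> x) + c \<odot> x"
  using jordan_linearized_op[of c c d x] by (simp add: jinv_simps jprod_one_left algebra_simps)

lemma jinv_LdLcLd: "d \<odot> (c \<odot> (d \<odot> x)) + d \<odot> (c \<odot> (d \<odot> x)) + ((d \<odot> d) \<odot> c) \<odot> x = d \<odot> x + d \<odot> x + (d \<odot> d) \<odot> (c \<odot> x)"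
  using jordan_linearized_op[of d c d x] by (simp add: jinv_simps jprod_one_left algebra_simps)

lemma jinv_sq_sq: "(c \<odot> c) \<odot> (d \<odot> d) = 1"
  using jinv_sq_commute[of d] by (simp add: jinv_simps)

text \<open>The definition of an inverse is not symmetric, and this is the missing half. The defect
  \<open>w\<close> is the value at \<open>d\<close> of the derivation \<open>jcomm c d\<close>,
  which kills \<open>c\<close>. Applying the derivation to known relations yields new ones until
  only \<open>w = 0\<close> is left.\<close>

lemma jinv_square: "c \<odot> (d \<odot> d) = d"
proof -
  define w where "w = c \<odot> (d \<odot> d) - d"
  have "c \<odot> (c \<odot> (d \<odot> d)) = 1"
    using jinv_LcLcLd[of d] jinv_sq_sq by (simp add: jinv_simps jprod_one_right)
  then have cw: "c \<odot> w = 0"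
    by (simp add: w_def jprod_linear_simps jinv_simps)
  have Tc: "jcomm c d c = 0"
    by (simp add: jcomm_def jinv_simps jprod_one_right)
  have Td: "jcomm c d d = w"
    by (simp add: jcomm_def jinv_simps jprod_one_right w_def)
  have Tw: "jcomm c d w = c \<odot> (d \<odot> w)"
    by (simp add: jcomm_def cw jprod_linear_simps)
  \<comment> \<open>The derivation is evaluated twice at the same element: by the product rule, and
    through its form \<open>w + d\<close>.\<close>
  have "jcomm c d (c \<odot> (d \<odot> d)) = c \<odot> (d \<odot> w) + c \<odot> (d \<odot> w)"
    by (simp add: jcomm_derivation Tc Td jprod_linear_simps jprod_commute[of w d])
  moreover have "c \<odot> (d \<odot> d) = w + d"
    by (simp add: w_def)
  ultimately have "jcomm c d w + w = c \<odot> (d \<odot> w) + c \<odot> (d \<odot> w)"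
    by (metis jcomm_add Td)
  then have cdw: "c \<odot> (d \<odot> w) = w"
    unfolding Tw by (metis add_left_cancel)
  have "((d \<odot> d) \<odot> c) \<odot> w = (d + w) \<odot> w"
    by (simp add: w_def jprod_commute[of c])
  then have *: "d \<odot> w + w \<odot> w = 0"
    using jinv_LdLcLd[of w] by (simp add: cdw cw jprod_linear_simps)
  \<comment> \<open>Differentiating the relation \<open>*\<close> produces a second relation between
    \<open>d \<odot> w\<close> and \<open>w \<odot> w\<close>, which isolates the square of
    \<open>w\<close>.\<close>
  have "jcomm c d (d \<odot> w) = w \<odot> w + d \<odot> w"
    by (simp add: jcomm_derivation Td Tw cdw)
  moreover have "jcomm c d (w \<odot> w) = w \<odot> w + w \<odot> w"
    by (simp add: jcomm_derivation Tw cdw)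
  ultimately have "(w \<odot> w + d \<odot> w) + (w \<odot> w + w \<odot> w) = 0"
    using * by (metis jcomm_add jcomm_zero)
  then have "w \<odot> w + w \<odot> w = 0"
    using * by (simp only: add.commute[of "w \<odot> w" "d \<odot> w"] add_0_left)
  then have "w \<odot> w = 0"
    by (rule double_eq_0D)
  with * have "d \<odot> w = 0"
    by simp
  with cdw have "w = 0"
    by (simp add: jprod_linear_simps)
  then show ?thesis
    by (simp add: w_def)
qed

lemma is_jinverse_sym: "is_jinverse d c"
  using jinv_square jprod_commute unfolding is_jinverse_def by (metis jinv_simps(2))

text \<open>Let T be \<open>jcomm c d\<close> and Q = 2 L(c)^2 - L(c^2), the quadratic operator of
  \<open>c\<close>. T commutes with L(c) and L(d), and fact \<open>U\<close> says QT = 0. Facts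
  \<open>UL\<close> and \<open>LU\<close> say that Q L(d) and L(d) Q equal L(c) plus and minus 2
  L(c) T. On the range of T both products vanish, and adding cancels the terms with T^2.\<close>

lemma jinv_jcomm_c: "c \<odot> jcomm c d x = 0"
proof -
  let ?T = "jcomm c d"
  have Tc: "?T c = 0"
    by (simp add: jcomm_def jinv_simps jprod_one_right)
  have Td: "?T d = 0"
    by (simp add: jcomm_def jinv_simps jprod_one_right jinv_square)
  have comm: "?T (c \<odot> x) = c \<odot> ?T x" "?T (d \<odot> x) = d \<odot> ?T x" for x
    by (simp_all add: jcomm_derivation Tc Td jprod_linear_simps)
  have U: "(c \<odot> c) \<odot> ?T x = c \<odot> (c \<odot> ?T x) + c \<odot> (c \<odot> ?T x)" for x
  proof -
    have "(c \<odot> c) \<odot> (c \<odot> (d \<odot> x)) = c \<odot> (c \<odot> (d \<odot> (c \<odot> x))) + c \<odot> (c \<odot> (d \<odot> (c \<odot> x))) - c \<odot> (c \<odot> x)"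
      using arg_cong[OF jinv_LcLdLc[of x], of "(\<odot>) c"]
      by (simp add: jprod_linear_simps jprod_square_commute eq_diff_eq)
    moreover have "(c \<odot> c) \<odot> (d \<odot> (c \<odot> x)) = c \<odot> (d \<odot> (c \<odot> (c \<odot> x))) + c \<odot> (d \<odot> (c \<odot> (c \<odot> x))) - c \<odot> (c \<odot> x)"
      using jinv_LcLdLc[of "c \<odot> x"] unfolding eq_diff_eq by (simp add: add.commute)
    ultimately have "(c \<odot> c) \<odot> ?T x = c \<odot> ?T (c \<odot> x) + c \<odot> ?T (c \<odot> x)"
      unfolding jcomm_def by (simp only: jprod_linear_simps) (simp add: algebra_simps)
    then show ?thesis
      by (simp add: comm)
  qed
  have UL: "c \<odot> (c \<odot> (d \<odot> y)) + c \<odot> (c \<odot> (d \<odot> y)) - (c \<odot> c) \<odot> (d \<odot> y) = c \<odot> ?T y + c \<odot> ?T y + c \<odot> y" for y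
    using jinv_LcLdLc[of y] unfolding jcomm_def by (simp add: jprod_linear_simps algebra_simps)
  have LU: "d \<odot> (c \<odot> (c \<odot> y)) + d \<odot> (c \<odot> (c \<odot> y)) - (c \<odot> c) \<odot> (d \<odot> y) = c \<odot> y - ?T (c \<odot> y) - ?T (c \<odot> y)" for y
    using jinv_LcLdLc[of y] unfolding jcomm_def by (simp add: jprod_linear_simps algebra_simps)
  have "c \<odot> ?T (?T x) + c \<odot> ?T (?T x) + c \<odot> ?T x = 0"
    using UL[of "?T x"] U[of "d \<odot> x"] by (simp add: comm)
  moreover have "c \<odot> ?T x - c \<odot> ?T (?T x) - c \<odot> ?T (?T x) = 0"
  proof -
    have "d \<odot> ((c \<odot> c) \<odot> ?T x) = d \<odot> (c \<odot> (c \<odot> ?T x)) + d \<odot> (c \<odot> (c \<odot> ?T x))"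
      by (simp add: U jprod_linear_simps)
    then show ?thesis
      using LU[of "?T x"] by (simp add: jinv_sq_commute comm)
  qed
  ultimately have "c \<odot> ?T x + c \<odot> ?T x = 0"
    by (simp add: algebra_simps)
  then show ?thesis
    by (rule double_eq_0D)
qed

end

text \<open>In operator form, L(d^2) L(c^2) = (2 L(c) L(d) - 1)^2. It serves both the commutation of
  L(c) with L(d) and the uniqueness of inverses.\<close>

lemma jinv_sq_sq_op:
  fixes c d :: "'a::unital_jordan_banach_algebra"
  assumes inv: "is_jinverse c d"
  shows "(d \<odot> d) \<odot> ((c \<odot> c) \<odot> x) + 4 *\<^sub>R (c \<odot> (d \<odot> x)) = 4 *\<^sub>R (c \<odot> (d \<odot> (c \<odot> (d \<odot> x)))) + x"
proof -
  have four: "4 *\<^sub>R v = v + v + (v + v)" for v :: 'a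
    using scaleR_add_left[of 2 2 v] by (simp add: scaleR_2)
  have "(c \<odot> c) \<odot> (d \<odot> (d \<odot> x)) + (c \<odot> c) \<odot> (d \<odot> (d \<odot> x)) + x
      = (d \<odot> d) \<odot> ((c \<odot> c) \<odot> x) + c \<odot> (d \<odot> x) + c \<odot> (d \<odot> x)"
    using jordan_linearized_op[of d d "c \<odot> c" x]
    by (simp add: jinv_simps[OF inv] jinv_sq_commute[OF inv] jprod_one_left algebra_simps)
  then show ?thesis
    using jinv_LcLdLc[OF inv, of "d \<odot> x"] unfolding four by (simp add: algebra_simps)
qed

text \<open>The commutator of L(c^2) and L(d^2) is computed in two ways. Polarization gives twice
  \<open>jcomm c d\<close>; the formula \<open>jinv_sq_sq_op\<close> for both orders gives four
  times it, because by \<open>quad\<close> the fourth-order terms agree. Hence it is zero.\<close>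

lemma jinv_operator_commute:
  fixes c d :: "'a::unital_jordan_banach_algebra"
  assumes inv: "is_jinverse c d"
  shows "c \<odot> (d \<odot> x) = d \<odot> (c \<odot> x)"
proof -
  let ?T = "jcomm c d"
  note inv' = is_jinverse_sym[OF inv]
  have cT: "c \<odot> ?T x = 0" for x
    by (rule jinv_jcomm_c[OF inv])
  have dT: "d \<odot> ?T x = 0" for x
    using jinv_jcomm_c[OF inv', of x] by (simp add: jcomm_swap[of c d] jprod_linear_simps)
  have "?T c = 0" "?T d = 0"
    by (simp_all add: jcomm_def jinv_simps[OF inv] jprod_one_right jinv_square[OF inv])
  then have Tcd: "?T (c \<odot> x) = 0" "?T (d \<odot> x) = 0" for x
    by (simp_all add: jcomm_derivation cT dT jprod_linear_simps)
  have dc: "d \<odot> (c \<odot> y) = c \<odot> (d \<odot> y) - ?T y" for y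
    by (simp add: jcomm_def)
  have quad: "d \<odot> (c \<odot> (d \<odot> (c \<odot> x))) = c \<odot> (d \<odot> (c \<odot> (d \<odot> x)))"
    by (simp add: dc jprod_linear_simps Tcd dT cT)
  have "(c \<odot> c) \<odot> ((d \<odot> d) \<odot> x) + d \<odot> (c \<odot> x) + d \<odot> (c \<odot> x) = (d \<odot> d) \<odot> ((c \<odot> c) \<odot> x) + c \<odot> (d \<odot> x) + c \<odot> (d \<odot> x)"
    using jordan_linearized[of "c \<odot> c" d x d]
    by (simp add: jinv_simps[OF inv] jprod_commute algebra_simps)
  then have "(c \<odot> c) \<odot> ((d \<odot> d) \<odot> x) - (d \<odot> d) \<odot> ((c \<odot> c) \<odot> x) = 2 *\<^sub>R ?T x"
    unfolding jcomm_def scaleR_2 by (simp add: algebra_simps)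
  moreover have "(c \<odot> c) \<odot> ((d \<odot> d) \<odot> x) - (d \<odot> d) \<odot> ((c \<odot> c) \<odot> x) = 4 *\<^sub>R ?T x"
    using jinv_sq_sq_op[OF inv, of x] jinv_sq_sq_op[OF inv', of x] unfolding jcomm_def quad
    by (simp add: algebra_simps)
  ultimately have "?T x = 0"
    by simp
  then show ?thesis
    by (simp add: jcomm_def)
qed

text \<open>The difference \<open>u\<close> of two inverses is killed by L(c) and L(c^2), and by
  commutation also by L(c) L(d); then every term of \<open>jinv_sq_sq_op\<close> except
  \<open>u\<close> itself vanishes.\<close>

lemma is_jinverse_unique:
  fixes c d d' :: "'a::unital_jordan_banach_algebra"
  assumes "is_jinverse c d" "is_jinverse c d'"
  shows "d' = d"
proof -
  define u where "u = d' - d"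
  have "c \<odot> u = 0" "(c \<odot> c) \<odot> u = 0"
    using assms by (simp_all add: is_jinverse_def u_def jprod_linear_simps)
  moreover from this have "c \<odot> (d \<odot> u) = 0"
    using jinv_operator_commute[OF assms(1), of u] by (simp add: jprod_linear_simps)
  ultimately have "u = 0"
    using jinv_sq_sq_op[OF assms(1), of u] by (simp add: jprod_linear_simps)
  then show ?thesis by (simp add: u_def)
qed

lemma jinverse_eq: "is_jinverse c d \<Longrightarrow> jinverse c = d"
  unfolding jinverse_def using is_jinverse_unique by (metis the_equality)

section \<open>Powers of an inverse\<close>

lemma jprod_square_jpow: "(a \<odot> a) \<odot> jpow a n = jpow a (Suc (Suc n))"
  by (induction n) (simp_all add: jprod_one_right jprod_square_commute[symmetric])

lemma jinv_jpow:
  fixes c d :: "'a::unital_jordan_banach_algebra"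
  assumes inv: "is_jinverse c d"
  shows "c \<odot> jpow d (Suc n) = jpow d n"
proof (induction n)
  case 0
  show ?case by (simp add: jprod_one_right jinv_simps[OF inv])
next
  case (Suc n)
  have "c \<odot> jpow d (Suc (Suc n)) = d \<odot> (c \<odot> jpow d (Suc n))"
    by (simp add: jinv_operator_commute[OF inv])
  then show ?case
    using Suc by simp
qed

text \<open>Multiplying by the square of \<open>c\<close> need not be multiplying twice by
  \<open>c\<close>, so the second equation of \<open>is_jinverse\<close> requires a shift rule of
  its own for the Neumann series.\<close>

lemma jinv_jpow_sq:
  fixes c d :: "'a::unital_jordan_banach_algebra"
  assumes inv: "is_jinverse c d"
  shows "(c \<odot> c) \<odot> jpow d (Suc (Suc n)) = jpow d n"
proof (induction n)
  case 0
  show ?case by (simp add: jprod_one_right jinv_sq_sq[OF inv])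
next
  case (Suc n)
  then show ?case
    using jinv_sq_commute[OF inv, of "jpow d (Suc (Suc n))"] by simp
qed

section \<open>The Hahn--Banach theorem for complex functionals\<close>

definition sublinear :: "('a::real_vector \<Rightarrow> real) \<Rightarrow> bool" where
  "sublinear p \<longleftrightarrow> (\<forall>u v. p (u + v) \<le> p u + p v) \<and> (\<forall>t>0. \<forall>u. p (t *\<^sub>R u) \<le> t * p u)"

lemma sublinear_add: "sublinear p \<Longrightarrow> p (u + v) \<le> p u + p v"
  by (simp add: sublinear_def)

lemma sublinear_scale:
  assumes "sublinear p" "t > 0"
  shows "p (t *\<^sub>R u) = t * p u"
proof (rule antisym)
  show "p (t *\<^sub>R u) \<le> t * p u"
    using assms by (simp add: sublinear_def)
  have "p ((1/t) *\<^sub>R t *\<^sub>R u) \<le> (1/t) * p (t *\<^sub>R u)"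
    using assms unfolding sublinear_def by (metis zero_less_divide_1_iff)
  then show "t * p u \<le> p (t *\<^sub>R u)"
    using assms(2) by (simp add: field_simps)
qed

lemma sublinear_zero: "sublinear p \<Longrightarrow> p 0 = 0"
  using sublinear_scale[of p 2 0] by simp

lemma sublinear_neg: "sublinear p \<Longrightarrow> - p (- u) \<le> p u"
  using sublinear_add[of p u "-u"] sublinear_zero[of p] by simp

text \<open>The one-dimensional step of Hahn--Banach. It has two uses: a minimal functional cannot
  be decreased, which makes it odd, and decreasing the norm at a chosen vector makes every linear
  functional below the result attain the norm there.\<close>

lemma sublinear_decrease:
  assumes p: "sublinear p"
  shows "\<exists>q. sublinear q \<and> (\<forall>x. q x \<le> p x) \<and> q (- y) \<le> - p y"
proof -
  define F where "F x t = p (x + t *\<^sub>R y) - t * p y" for x t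
  define q where "q x = (INF t\<in>{0..}. F x t)" for x
  have py: "p (t *\<^sub>R y) = t * p y" if "t \<ge> 0" for t
    using that sublinear_scale[OF p, of t y] sublinear_zero[OF p] by (cases "t = 0") auto
  \<comment> \<open>A lower bound independent of \<open>t\<close>, so that the infimum is
    finite.\<close>
  have lb: "- p (- x) \<le> F x t" if "t \<ge> 0" for x t
    using sublinear_add[OF p, of "x + t *\<^sub>R y" "- x"] py[OF that] by (simp add: F_def)
  have bdd: "bdd_below (F x ` {0..})" for x
    using lb by (intro bdd_belowI2[where m = "- p (- x)"]) auto
  have le: "q x \<le> F x t" if "t \<ge> 0" for x t
    unfolding q_def using bdd that by (intro cINF_lower) auto
  have ge: "m \<le> q x" if "\<And>t. t \<ge> 0 \<Longrightarrow> m \<le> F x t" for x m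
    unfolding q_def using that by (intro cINF_greatest) auto
  have "q (u + v) \<le> q u + q v" for u v
  proof -
    have "q (u + v) \<le> F u s + F v t" if "s \<ge> 0" "t \<ge> 0" for s t
    proof -
      have "q (u + v) \<le> F (u + v) (s + t)"
        using that by (intro le) auto
      also have "\<dots> \<le> F u s + F v t"
        using sublinear_add[OF p, of "u + s *\<^sub>R y" "v + t *\<^sub>R y"] by (simp add: F_def algebra_simps)
      finally show ?thesis .
    qed
    then have "q (u + v) - F v t \<le> q u" if "t \<ge> 0" for t
      using that by (intro ge) (simp add: algebra_simps)
    then have "q (u + v) - q u \<le> q v"
      by (intro ge) (simp add: algebra_simps)
    then show ?thesis by simp
  qed
  moreover have "q (c *\<^sub>R u) \<le> c * q u" if "c > 0" for c u
  proof -
    have "q (c *\<^sub>R u) / c \<le> q u"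
    proof (rule ge)
      fix t :: real assume "t \<ge> 0"
      then have "q (c *\<^sub>R u) \<le> F (c *\<^sub>R u) (c * t)"
        using that by (intro le) auto
      also have "\<dots> = c * F u t"
        using sublinear_scale[OF p that, of "u + t *\<^sub>R y"] by (simp add: F_def algebra_simps)
      finally show "q (c *\<^sub>R u) / c \<le> F u t"
        using that by (simp add: field_simps)
    qed
    then show ?thesis
      using that by (simp add: field_simps)
  qed
  ultimately have "sublinear q"
    by (simp add: sublinear_def)
  moreover have "q x \<le> p x" for x
    using le[of 0 x] by (simp add: F_def)
  moreover have "q (- y) \<le> - p y"
    using le[of 1 "-y"] sublinear_zero[OF p] by (simp add: F_def)
  ultimately show ?thesis by blast
qed

text \<open>The bound \<open>N\<close> keeps the infimum finite, since a sublinear \<open>p\<close>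
  satisfies \<open>- p (- x) \<le> p x\<close>. The chain condition gives subadditivity: of two
  members the smaller one can be used at both arguments.\<close>

lemma sublinear_INF_chain:
  assumes "C \<noteq> {}" and sub: "\<And>p. p \<in> C \<Longrightarrow> sublinear p" and dom: "\<And>p x. p \<in> C \<Longrightarrow> p x \<le> N x"
    and chain: "\<And>p q. p \<in> C \<Longrightarrow> q \<in> C \<Longrightarrow> (\<forall>x. p x \<le> q x) \<or> (\<forall>x. q x \<le> p x)"
  shows "sublinear (\<lambda>x. INF p\<in>C. p x) \<and> (\<forall>p\<in>C. \<forall>x. (INF p\<in>C. p x) \<le> p x)"
proof -
  let ?m = "\<lambda>x. INF p\<in>C. p x"
  have lb: "- N (- x) \<le> p x" if "p \<in> C" for p x
    using sublinear_neg[OF sub[OF that], of x] dom[OF that, of "-x"] by simp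
  have bdd: "bdd_below ((\<lambda>p. p x) ` C)" for x
    using lb by (intro bdd_belowI2[where m = "- N (- x)"]) auto
  have le: "?m x \<le> p x" if "p \<in> C" for p x
    using bdd that by (intro cINF_lower) auto
  have ge: "k \<le> ?m x" if "\<And>p. p \<in> C \<Longrightarrow> k \<le> p x" for x k
    using \<open>C \<noteq> {}\<close> that by (intro cINF_greatest) auto
  have "?m (u + v) \<le> ?m u + ?m v" for u v
  proof -
    have "?m (u + v) \<le> p u + q v" if pq: "p \<in> C" "q \<in> C" for p q
    proof -
      obtain r where r: "r \<in> C" "\<And>x. r x \<le> p x" "\<And>x. r x \<le> q x"
        using chain[OF pq] pq by blast
      have "?m (u + v) \<le> r (u + v)"
        by (rule le[OF r(1)])
      also have "\<dots> \<le> r u + r v"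
        by (rule sublinear_add[OF sub[OF r(1)]])
      also have "\<dots> \<le> p u + q v"
        using r by (intro add_mono)
      finally show ?thesis .
    qed
    then have "?m (u + v) - q v \<le> ?m u" if "q \<in> C" for q
      using that by (intro ge) (simp add: algebra_simps)
    then have "?m (u + v) - ?m u \<le> ?m v"
      by (intro ge) (simp add: algebra_simps)
    then show ?thesis by simp
  qed
  moreover have "?m (t *\<^sub>R u) \<le> t * ?m u" if "t > 0" for t u
  proof -
    have "?m (t *\<^sub>R u) / t \<le> ?m u"
    proof (rule ge)
      fix p assume p: "p \<in> C"
      show "?m (t *\<^sub>R u) / t \<le> p u"
        using le[OF p, of "t *\<^sub>R u"] that sublinear_scale[OF sub[OF p] that, of u] by (simp add: field_simps)
    qed
    then show ?thesis
      using that by (simp add: field_simps)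
  qed
  ultimately show ?thesis
    using le unfolding sublinear_def by blast
qed

text \<open>A minimal sublinear functional is linear, so Zorn's lemma can be applied to total functions.\<close>

lemma sublinear_dominates_linear:
  fixes N :: "'a::real_vector \<Rightarrow> real"
  assumes N: "sublinear N"
  shows "\<exists>f. linear f \<and> (\<forall>x. f x \<le> N x)"
proof -
  define A where "A = {p. sublinear p \<and> (\<forall>x. p x \<le> N x)}"
  \<comment> \<open>The order is reversed, so that a maximal element in Zorn's sense is a minimal
    functional.\<close>
  define P where "P p q \<longleftrightarrow> (\<forall>x::'a. q x \<le> (p x :: real))" for p q
  have "\<exists>m\<in>A. \<forall>a\<in>A. P m a \<longrightarrow> a = m"
  proof (rule predicate_Zorn)
    show "partial_order_on A (relation_of P A)"
      by (rule partial_order_on_relation_ofI) (auto simp: P_def fun_eq_iff intro: order_trans antisym)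
    fix C assume C: "C \<in> Chains (relation_of P A)"
    then have CA: "p \<in> A" if "p \<in> C" for p
      using that by (auto simp: Chains_def relation_of_def)
    show "\<exists>u\<in>A. \<forall>a\<in>C. P a u"
    proof (cases "C = {}")
      case True
      then show ?thesis using N by (auto simp: A_def)
    next
      case False
      have inf: "sublinear (\<lambda>x. INF p\<in>C. p x) \<and> (\<forall>p\<in>C. \<forall>x. (INF p\<in>C. p x) \<le> p x)"
      proof (rule sublinear_INF_chain[OF False, of N])
        fix p q assume "p \<in> C" "q \<in> C"
        then show "(\<forall>x. p x \<le> q x) \<or> (\<forall>x. q x \<le> p x)"
          using C by (fastforce simp: Chains_def relation_of_def P_def)
      qed (use CA in \<open>auto simp: A_def\<close>)
      obtain p where "p \<in> C" using False by blast
      with inf have "(\<lambda>x. INF p\<in>C. p x) \<in> A"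
        using CA by (fastforce simp: A_def intro: order_trans)
      then show ?thesis
        using inf unfolding P_def by (intro bexI[where x = "\<lambda>x. INF p\<in>C. p x"]) auto
    qed
  qed
  then obtain f where f: "sublinear f" "\<And>x. f x \<le> N x"
    and min: "\<And>a. sublinear a \<Longrightarrow> (\<And>x. a x \<le> N x) \<Longrightarrow> (\<And>x. a x \<le> f x) \<Longrightarrow> a = f"
    by (auto simp: A_def P_def)
  have neg: "f (- y) = - f y" for y
  proof -
    obtain q where q: "sublinear q" "\<And>x. q x \<le> f x" "q (- y) \<le> - f y"
      using sublinear_decrease[OF f(1), of y] by blast
    then have "q = f"
      using f(2) by (intro min) (auto intro: order_trans)
    then show ?thesis
      using q(3) sublinear_neg[OF f(1), of "- y"] by simp
  qed
  have add: "f (u + v) = f u + f v" for u v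
    using sublinear_add[OF f(1), of u v] sublinear_add[OF f(1), of "-u" "-v"] neg[of "u + v"]
    by (simp add: neg)
  have "f (t *\<^sub>R u) = t * f u" for t u
  proof (cases t "0::real" rule: linorder_cases)
    case less
    then show ?thesis
      using sublinear_scale[OF f(1), of "-t" u] neg[of "t *\<^sub>R u"] by simp
  qed (use sublinear_scale[OF f(1)] sublinear_zero[OF f(1)] in auto)
  then have "linear f"
    using add by (intro linearI) auto
  then show ?thesis
    using f(2) by blast
qed

section \<open>Complex functionals of norm at most one\<close>

definition cfunctional :: "('a::complex_banach \<Rightarrow> complex) \<Rightarrow> bool" where
  "cfunctional \<phi> \<longleftrightarrow> (\<forall>x y. \<phi> (x + y) = \<phi> x + \<phi> y) \<and> (\<forall>c x. \<phi> (c *\<^sub>C x) = c * \<phi> x) \<and>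
     (\<forall>x. cmod (\<phi> x) \<le> norm x)"

lemma cfunctional_scaleC: "cfunctional \<phi> \<Longrightarrow> \<phi> (c *\<^sub>C x) = c * \<phi> x"
  and cfunctional_norm_le: "cfunctional \<phi> \<Longrightarrow> cmod (\<phi> x) \<le> norm x"
  by (simp_all add: cfunctional_def)

lemma cfunctional_bounded_linear: "cfunctional \<phi> \<Longrightarrow> bounded_linear \<phi>"
  by (rule bounded_linear_intro[where K = 1])
     (simp_all add: cfunctional_def scaleR_scaleC scaleR_conv_of_real)

lemma cfunctional_diff: "cfunctional \<phi> \<Longrightarrow> \<phi> (x - y) = \<phi> x - \<phi> y"
  by (simp add: bounded_linear.linear cfunctional_bounded_linear linear_diff)

text \<open>Decreasing the norm in direction \<open>x\<close> first forces any dominated linear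
  \<open>f\<close> to satisfy \<open>f x \<ge> norm x\<close>, in place of extending a functional
  from the line through \<open>x\<close>. The complex functional is the usual one with real part
  \<open>f\<close>.\<close>

theorem hahn_banach_complex:
  fixes x :: "'a::complex_banach"
  shows "\<exists>\<phi>. cfunctional \<phi> \<and> cmod (\<phi> x) = norm x"
proof -
  have "sublinear (norm :: 'a \<Rightarrow> real)"
    by (simp add: sublinear_def norm_triangle_ineq)
  then obtain N :: "'a \<Rightarrow> real" where N: "sublinear N" "\<And>x. N x \<le> norm x" "N (- x) \<le> - norm x"
    using sublinear_decrease by blast
  then obtain f where f: "linear f" "\<And>y. f y \<le> N y"
    using sublinear_dominates_linear by blast
  have fle: "f y \<le> norm y" for y
    using f(2) N(2) order_trans by blast
  have fx: "norm x \<le> f x"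
    using f(2)[of "-x"] N(3) by (simp add: linear_neg[OF f(1)])
  define \<phi> where "\<phi> y = Complex (f y) (- f (\<i> *\<^sub>C y))" for y
  have add: "\<phi> (u + v) = \<phi> u + \<phi> v" for u v
    by (simp add: \<phi>_def complex_eq_iff scaleC_add_right linear_add[OF f(1)])
  have R: "\<phi> (of_real r *\<^sub>C u) = of_real r * \<phi> u" for r u
  proof -
    have "\<i> *\<^sub>C of_real r *\<^sub>C u = r *\<^sub>R (\<i> *\<^sub>C u)"
      by (simp add: scaleR_scaleC scaleC_scaleC mult.commute)
    then show ?thesis
      by (simp add: \<phi>_def complex_eq_iff scaleR_scaleC[symmetric] linear_scale[OF f(1)])
  qed
  have I: "\<phi> (\<i> *\<^sub>C u) = \<i> * \<phi> u" for u
    by (simp add: \<phi>_def complex_eq_iff scaleC_scaleC scaleC.minus_left scaleC_one linear_neg[OF f(1)])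
  have scale: "\<phi> (c *\<^sub>C u) = c * \<phi> u" for c u
  proof -
    have "c *\<^sub>C u = of_real (Re c) *\<^sub>C u + \<i> *\<^sub>C of_real (Im c) *\<^sub>C u"
      by (subst complex_eq[of c]) (simp add: scaleC_add_left scaleC_scaleC)
    then have "\<phi> (c *\<^sub>C u) = (of_real (Re c) + \<i> * of_real (Im c)) * \<phi> u"
      by (simp add: add R I algebra_simps)
    then show ?thesis
      using complex_eq[of c] by simp
  qed
  have norm: "cmod (\<phi> u) \<le> norm u" for u
  proof (cases "\<phi> u = 0")
    case False
    \<comment> \<open>A unit factor rotating the value at \<open>u\<close> onto the positive axis,
      where it equals its real part and the bound on \<open>f\<close> applies.\<close>
    define c where "c = cnj (\<phi> u) / of_real (cmod (\<phi> u))"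
    have c: "cmod c = 1"
      using False by (simp add: c_def norm_divide)
    have "\<phi> (c *\<^sub>C u) = of_real (cmod (\<phi> u))"
      using False by (simp add: scale c_def field_simps complex_norm_square[symmetric] power2_eq_square)
    then have "cmod (\<phi> u) = Re (\<phi> (c *\<^sub>C u))"
      by simp
    also have "\<dots> \<le> norm (c *\<^sub>C u)"
      using fle by (simp add: \<phi>_def)
    finally show ?thesis
      by (simp add: norm_scaleC c)
  qed simp
  have "norm x \<le> Re (\<phi> x)"
    using fx by (simp add: \<phi>_def)
  then have "norm x \<le> cmod (\<phi> x)"
    using complex_Re_le_cmod order_trans by blast
  then show ?thesis
    using add scale norm antisym unfolding cfunctional_def by blast
qed

lemma norm_le_cfunctionalI:
  fixes x :: "'a::complex_banach"
  assumes "\<And>\<phi>. cfunctional \<phi> \<Longrightarrow> cmod (\<phi> x) \<le> B"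
  shows "norm x \<le> B"
  using hahn_banach_complex[of x] assms by metis

lemma eq_cfunctionalI:
  fixes x y :: "'a::complex_banach"
  assumes "\<And>\<phi>. cfunctional \<phi> \<Longrightarrow> \<phi> x = \<phi> y"
  shows "x = y"
proof -
  have "norm (x - y) \<le> 0"
    using assms by (intro norm_le_cfunctionalI) (simp add: cfunctional_diff)
  then show ?thesis by simp
qed

section \<open>The resolvent\<close>

lemma norm_jpow_le:
  fixes a :: "'a::unital_jordan_banach_algebra"
  shows "norm (jpow a n) \<le> norm a ^ n * norm (1::'a)"
proof (induction n)
  case (Suc n)
  have "norm (a \<odot> jpow a n) \<le> norm a * norm (jpow a n)"
    by (rule norm_jprod_le)
  also have "\<dots> \<le> norm a * (norm a ^ n * norm (1::'a))"
    by (intro mult_left_mono Suc) simp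
  finally show ?case by (simp add: mult.assoc)
qed simp

lemma summable_scaleC_jpow:
  fixes a :: "'a::unital_jordan_banach_algebra"
  assumes "cmod s * norm a < 1"
  shows "summable (\<lambda>n. s ^ n *\<^sub>C jpow a n)"
proof (rule summable_comparison_test')
  show "summable (\<lambda>n. (cmod s * norm a) ^ n * norm (1::'a))"
    using assms by (intro summable_mult2 summable_geometric) simp
  show "norm (s ^ n *\<^sub>C jpow a n) \<le> (cmod s * norm a) ^ n * norm (1::'a)" for n
    using mult_left_mono[OF norm_jpow_le[of a n], of "cmod s ^ n"]
    by (simp add: norm_scaleC norm_power power_mult_distrib mult.assoc)
qed

lemma jprod_suminf: "summable f \<Longrightarrow> x \<odot> suminf f = (\<Sum>n. x \<odot> (f n :: 'a::jordan_banach_algebra))"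
  by (rule bounded_linear.suminf[OF jprod.bounded_linear_right])

lemma scaleC_suminf: "summable f \<Longrightarrow> c *\<^sub>C suminf f = (\<Sum>n. c *\<^sub>C (f n :: 'a::complex_banach))"
  by (rule bounded_linear.suminf[OF scaleC.bounded_linear_right])

text \<open>The shift rules for powers of \<open>d\<close> replace the telescoping of an associative
  geometric series. The last conclusion is the resolvent identity behind continuity.\<close>

lemma is_jinverse_perturb:
  fixes c d :: "'a::unital_jordan_banach_algebra"
  assumes inv: "is_jinverse c d" and h: "cmod h * norm d < 1"
  defines "e \<equiv> (\<Sum>n. h ^ n *\<^sub>C jpow d (Suc n))"
  shows "summable (\<lambda>n. h ^ n *\<^sub>C jpow d (Suc n))"
    and "is_jinverse (c - h *\<^sub>C 1) e"
    and "e = d + h *\<^sub>C (d \<odot> e)"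
proof -
  let ?t = "\<lambda>n. h ^ n *\<^sub>C jpow d n" and ?s = "\<lambda>n. h ^ n *\<^sub>C jpow d (Suc n)"
  have t: "summable ?t"
    by (rule summable_scaleC_jpow[OF h])
  have s_eq: "?s n = d \<odot> ?t n" for n
    by (simp add: jprod_scaleC_right)
  show s: "summable ?s"
    unfolding s_eq by (rule bounded_linear.summable[OF jprod.bounded_linear_right t])
  define E where "E = suminf ?t"
  have e: "e = d \<odot> E"
    unfolding e_def E_def s_eq by (rule jprod_suminf[OF t, symmetric])
  have E: "E = 1 + h *\<^sub>C e"
  proof -
    have "(\<Sum>n. ?t (Suc n)) = E - 1"
      using suminf_split_head[OF t] by (simp add: E_def scaleC_one)
    moreover have "(\<Sum>n. ?t (Suc n)) = h *\<^sub>C e"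
      unfolding e_def scaleC_suminf[OF s] by (simp add: scaleC_scaleC)
    ultimately show ?thesis by (simp add: algebra_simps)
  qed
  show "e = d + h *\<^sub>C (d \<odot> e)"
    using e unfolding E by (simp add: jprod.add_right jprod_one_right jprod_scaleC_right)
  have ce: "c \<odot> e = E"
    unfolding e_def E_def jprod_suminf[OF s] by (simp only: jprod_scaleC_right jinv_jpow[OF inv])
  have cce: "(c \<odot> c) \<odot> e = c + h *\<^sub>C E"
  proof -
    have "(c \<odot> c) \<odot> e = (\<Sum>n. (c \<odot> c) \<odot> ?s n)"
      unfolding e_def by (rule jprod_suminf[OF s])
    \<comment> \<open>The shift by two applies from the second power of \<open>d\<close> on; the
      separated first term contributes \<open>c\<close>.\<close>
    also have "\<dots> = (c \<odot> c) \<odot> ?s 0 + (\<Sum>n. (c \<odot> c) \<odot> ?s (Suc n))"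
      using suminf_split_head[OF bounded_linear.summable[OF jprod.bounded_linear_right[of "c \<odot> c"] s]]
      by simp
    also have "(\<Sum>n. (c \<odot> c) \<odot> ?s (Suc n)) = (\<Sum>n. h *\<^sub>C ?t n)"
      by (simp only: jprod_scaleC_right jinv_jpow_sq[OF inv] scaleC_scaleC power_Suc)
    also have "\<dots> = h *\<^sub>C E"
      unfolding E_def by (rule scaleC_suminf[OF t, symmetric])
    finally show ?thesis
      by (simp add: scaleC_one jprod_one_right jinv_simps[OF inv])
  qed
  have "(c - h *\<^sub>C 1) \<odot> e = 1"
    by (simp add: jprod_linear_simps jprod_scaleC_left jprod_one_left ce E)
  moreover have "((c - h *\<^sub>C 1) \<odot> (c - h *\<^sub>C 1)) \<odot> e = c - h *\<^sub>C 1"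
    by (simp add: jprod_linear_simps jprod_scaleC_left jprod_scaleC_right jprod_one_left jprod_one_right
        ce cce E scaleC_add_right scaleC.diff_right scaleC_scaleC algebra_simps)
  ultimately show "is_jinverse (c - h *\<^sub>C 1) e"
    by (simp add: is_jinverse_def)
qed

lemma is_jinverse_neumann:
  fixes b :: "'a::unital_jordan_banach_algebra"
  assumes "norm b < cmod w"
  shows "\<exists>e. is_jinverse (w *\<^sub>C 1 - b) e"
proof -
  have w: "w \<noteq> 0"
    using assms norm_ge_zero[of b] by auto
  let ?t = "\<lambda>n. (1/w) ^ n *\<^sub>C jpow b n"
  define E where "E = suminf ?t"
  have t: "summable ?t"
    using assms w by (intro summable_scaleC_jpow) (simp add: norm_divide)
  have t1: "summable (\<lambda>n. ?t (Suc n))"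
    using summable_Suc_iff[of ?t] t by blast
  have bE: "b \<odot> E = w *\<^sub>C (E - 1)"
  proof -
    have "b \<odot> E = (\<Sum>n. w *\<^sub>C ?t (Suc n))"
      unfolding E_def jprod_suminf[OF t] using w by (simp add: jprod_scaleC_right scaleC_scaleC)
    also have "\<dots> = w *\<^sub>C (\<Sum>n. ?t (Suc n))"
      using scaleC_suminf[OF t1] by simp
    finally show ?thesis
      using suminf_split_head[OF t] by (simp add: E_def scaleC_one)
  qed
  have bbE: "(b \<odot> b) \<odot> E = w *\<^sub>C w *\<^sub>C (E - 1) - w *\<^sub>C b"
  proof -
    have "(b \<odot> b) \<odot> E = (\<Sum>n. b \<odot> (b \<odot> ?t n))"
      unfolding E_def jprod_suminf[OF t] by (simp only: jprod_scaleC_right jprod_square_jpow) simp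
    also have "\<dots> = b \<odot> (b \<odot> E)"
      unfolding E_def jprod_suminf[OF t]
      by (rule jprod_suminf[symmetric]) (rule bounded_linear.summable[OF jprod.bounded_linear_right t])
    finally show ?thesis
      by (simp add: bE jprod_scaleC_right jprod_linear_simps jprod_one_right scaleC.diff_right)
  qed
  have "is_jinverse (w *\<^sub>C 1 - b) ((1/w) *\<^sub>C E)"
    unfolding is_jinverse_def using w
    by (simp add: jprod_linear_simps jprod_scaleC_left jprod_scaleC_right jprod_one_left jprod_one_right
        bE bbE scaleC_add_right scaleC.diff_right scaleC_scaleC scaleC_one algebra_simps)
  then show ?thesis by blast
qed

definition resolvent :: "'a::unital_jordan_banach_algebra \<Rightarrow> complex \<Rightarrow> 'a" where
  "resolvent a z = jinverse (z *\<^sub>C 1 - a)"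

lemma is_jinverse_minus: "is_jinverse c d \<Longrightarrow> is_jinverse (- c) (- d)"
  by (simp add: is_jinverse_def jprod_linear_simps)

lemma not_in_jspectrumI: "is_jinverse (z *\<^sub>C 1 - a) d \<Longrightarrow> z \<notin> jspectrum a"
  using is_jinverse_minus[of "z *\<^sub>C 1 - a" d] by (auto simp: jspectrum_def jinvertible_def)

lemma resolvent_eq: "is_jinverse (z *\<^sub>C 1 - a) d \<Longrightarrow> resolvent a z = d"
  unfolding resolvent_def by (rule jinverse_eq)

lemma is_jinverse_resolvent:
  assumes "z \<notin> jspectrum a"
  shows "is_jinverse (z *\<^sub>C 1 - a) (resolvent a z)"
proof -
  obtain d where "is_jinverse (a - z *\<^sub>C 1) d"
    using assms by (auto simp: jspectrum_def jinvertible_def)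
  then have d: "is_jinverse (z *\<^sub>C 1 - a) (- d)"
    using is_jinverse_minus by fastforce
  with resolvent_eq[OF d] show ?thesis by simp
qed

lemma jspectrum_subset_cball: "jspectrum a \<subseteq> cball 1 (norm (a - 1))"
proof
  fix z assume z: "z \<in> jspectrum a"
  show "z \<in> cball 1 (norm (a - 1))"
  proof (rule ccontr)
    assume "z \<notin> cball 1 (norm (a - 1))"
    then have "norm (a - 1) < cmod (z - 1)"
      by (simp add: dist_norm norm_minus_commute)
    then obtain e where "is_jinverse ((z - 1) *\<^sub>C 1 - (a - 1)) e"
      using is_jinverse_neumann by blast
    then have "is_jinverse (z *\<^sub>C 1 - a) e"
      by (simp add: scaleC.diff_left scaleC_one)
    then show False
      using z not_in_jspectrumI by blast
  qed
qed

lemma resolvent_expansion: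
  assumes z0: "z0 \<notin> jspectrum a" and z: "cmod (z0 - z) * norm (resolvent a z0) < 1"
  shows "z \<notin> jspectrum a"
    and "(\<lambda>n. (z0 - z) ^ n *\<^sub>C jpow (resolvent a z0) (Suc n)) sums resolvent a z"
    and "resolvent a z = resolvent a z0 + (z0 - z) *\<^sub>C (resolvent a z0 \<odot> resolvent a z)"
proof -
  note p = is_jinverse_perturb[OF is_jinverse_resolvent[OF z0] z]
  have "z0 *\<^sub>C 1 - a - (z0 - z) *\<^sub>C 1 = z *\<^sub>C 1 - a"
    by (simp add: scaleC.diff_left)
  note inv = p(2)[unfolded this]
  show "z \<notin> jspectrum a"
    by (rule not_in_jspectrumI[OF inv])
  show "(\<lambda>n. (z0 - z) ^ n *\<^sub>C jpow (resolvent a z0) (Suc n)) sums resolvent a z"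
    unfolding resolvent_eq[OF inv] using p(1) by (rule summable_sums)
  show "resolvent a z = resolvent a z0 + (z0 - z) *\<^sub>C (resolvent a z0 \<odot> resolvent a z)"
    unfolding resolvent_eq[OF inv] by (rule p(3))
qed

text \<open>The bound 1/2, rather than any number below 1, lets the error in the resolvent identity
  be absorbed, so that the resolvent near \<open>z0\<close> has at most twice its norm at
  \<open>z0\<close>.\<close>

lemma resolvent_expansion_ball:
  obtains r where "r > 0" "\<And>z. z \<in> ball z0 r \<Longrightarrow> cmod (z0 - z) * norm (resolvent a z0) \<le> 1 / 2"
proof
  define r where "r = 1 / (2 * (norm (resolvent a z0) + 1))"
  show "r > 0"
    by (simp add: r_def add_nonneg_pos)
  fix z assume "z \<in> ball z0 r"
  then have "cmod (z0 - z) * norm (resolvent a z0) \<le> r * (norm (resolvent a z0) + 1)"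
    using \<open>r > 0\<close> by (intro mult_mono) (auto simp: dist_norm)
  also have "\<dots> = 1 / 2"
    by (simp add: r_def field_simps add_nonneg_eq_0_iff)
  finally show "cmod (z0 - z) * norm (resolvent a z0) \<le> 1 / 2" .
qed

lemma open_Compl_jspectrum: "open (- jspectrum a)"
  unfolding open_contains_ball
proof
  fix z0 assume z0: "z0 \<in> - jspectrum a"
  obtain r where r: "r > 0" "\<And>z. z \<in> ball z0 r \<Longrightarrow> cmod (z0 - z) * norm (resolvent a z0) \<le> 1 / 2"
    using resolvent_expansion_ball[of z0 a] by blast
  have "ball z0 r \<subseteq> - jspectrum a"
    using resolvent_expansion(1)[of z0 a] z0 r(2) by fastforce
  then show "\<exists>e>0. ball z0 e \<subseteq> - jspectrum a"
    using r(1) by blast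
qed

lemma compact_jspectrum: "compact (jspectrum a)"
proof -
  have "bounded (jspectrum a)"
    using jspectrum_subset_cball bounded_cball bounded_subset by blast
  then show ?thesis
    using open_Compl_jspectrum[of a] by (simp add: compact_eq_bounded_closed closed_def)
qed

lemma continuous_on_resolvent: "continuous_on (- jspectrum a) (resolvent a)"
proof (rule continuous_at_imp_continuous_on, rule ballI)
  fix z0 assume z0: "z0 \<in> - jspectrum a"
  let ?d = "resolvent a z0"
  obtain r where r: "r > 0" "\<And>z. z \<in> ball z0 r \<Longrightarrow> cmod (z0 - z) * norm ?d \<le> 1 / 2"
    using resolvent_expansion_ball[of z0 a] by blast
  have "norm (resolvent a z - ?d) \<le> cmod (z0 - z) * (2 * norm ?d * norm ?d)" if "z \<in> ball z0 r" for z
  proof -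
    let ?e = "resolvent a z"
    have eq: "?e = ?d + (z0 - z) *\<^sub>C (?d \<odot> ?e)"
      using z0 r(2)[OF that] by (intro resolvent_expansion(3)) auto
    have "norm ((z0 - z) *\<^sub>C (?d \<odot> ?e)) \<le> cmod (z0 - z) * (norm ?d * norm ?e)"
      unfolding norm_scaleC by (intro mult_left_mono norm_jprod_le) simp
    then have *: "norm (?e - ?d) \<le> cmod (z0 - z) * (norm ?d * norm ?e)"
      using eq by (metis add_diff_cancel_left')
    also have "\<dots> \<le> 1/2 * norm ?e"
      using mult_right_mono[OF r(2)[OF that], of "norm ?e"] by (simp add: mult.assoc)
    finally have "norm ?e \<le> 2 * norm ?d"
      using norm_triangle_ineq2[of ?e ?d] by simp
    then have "cmod (z0 - z) * (norm ?d * norm ?e) \<le> cmod (z0 - z) * (norm ?d * (2 * norm ?d))"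
      by (intro mult_left_mono) auto
    with * show ?thesis by (simp add: mult_ac)
  qed
  then have "\<forall>\<^sub>F z in at z0. norm (resolvent a z - ?d) \<le> cmod (z0 - z) * (2 * norm ?d * norm ?d)"
    using r(1) by (auto simp: eventually_at dist_commute intro!: exI[of _ r])
  moreover have "((\<lambda>z. cmod (z0 - z) * (2 * norm ?d * norm ?d)) \<longlongrightarrow> 0) (at z0)"
    by (rule tendsto_eq_intros | simp)+
  ultimately have "((\<lambda>z. resolvent a z - ?d) \<longlongrightarrow> 0) (at z0)"
    by (rule Lim_null_comparison)
  then show "isCont (resolvent a) z0"
    by (simp add: isCont_def LIM_zero_iff)
qed

lemma holomorphic_on_cfunctional_resolvent:
  assumes \<phi>: "cfunctional \<phi>"
  shows "(\<lambda>z. \<phi> (resolvent a z)) holomorphic_on - jspectrum a"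
proof -
  have "(\<lambda>z. \<phi> (resolvent a z)) field_differentiable at z0" if z0: "z0 \<notin> jspectrum a" for z0
  proof -
    let ?d = "resolvent a z0"
    obtain r where r: "r > 0" "\<And>z. z \<in> ball z0 r \<Longrightarrow> cmod (z0 - z) * norm ?d \<le> 1 / 2"
      using resolvent_expansion_ball[of z0 a] by blast
    have "(\<lambda>z. \<phi> (resolvent a z)) holomorphic_on ball z0 r"
    proof (rule power_series_holomorphic)
      fix z assume "z \<in> ball z0 r"
      then have "cmod (z0 - z) * norm ?d < 1"
        using r(2) by fastforce
      then have "(\<lambda>n. \<phi> ((z0 - z) ^ n *\<^sub>C jpow ?d (Suc n))) sums \<phi> (resolvent a z)"
        using z0 by (intro bounded_linear.sums[OF cfunctional_bounded_linear[OF \<phi>]] resolvent_expansion(2)) auto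
      moreover have "\<phi> ((z0 - z) ^ n *\<^sub>C jpow ?d (Suc n)) = ((-1) ^ n * \<phi> (jpow ?d (Suc n))) * (z - z0) ^ n" for n
      proof -
        have "(z0 - z) ^ n = (-1) ^ n * (z - z0) ^ n"
          by (metis minus_diff_eq power_minus)
        then show ?thesis
          by (simp only: cfunctional_scaleC[OF \<phi>] mult_ac)
      qed
      ultimately show "(\<lambda>n. ((-1) ^ n * \<phi> (jpow ?d (Suc n))) * (z - z0) ^ n) sums \<phi> (resolvent a z)"
        by (simp only:)
    qed
    then show ?thesis
      using r(1) by (meson centre_in_ball holomorphic_on_imp_differentiable_at open_ball)
  qed
  then show ?thesis
    by (simp add: holomorphic_on_def field_differentiable_at_within)
qed

text \<open>With w = z - 1 and b = a - 1 the inverse satisfies e = (1/w)(1 + b \<odot> e). The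
  condition on \<open>z\<close> absorbs the last term and gives the first bound; inserting the
  equation into itself once leaves the remainder \<open>b \<odot> (b \<odot> e)\<close> divided by
  w^2.\<close>

lemma resolvent_bounds:
  fixes a :: "'a::unital_jordan_banach_algebra"
  assumes z: "2 * norm (a - 1) \<le> cmod (z - 1)" "z \<noteq> 1"
  shows "norm (resolvent a z) \<le> 2 * norm (1::'a) / cmod (z - 1)"
    and "norm (resolvent a z - (1 / (z - 1)) *\<^sub>C 1 - (1 / (z - 1)\<^sup>2) *\<^sub>C (a - 1))
       \<le> 2 * norm (1::'a) * (norm (a - 1))\<^sup>2 / cmod (z - 1) ^ 3"
proof -
  define w b e where "w = z - 1" and "b = a - 1" and "e = resolvent a z"
  have w: "w \<noteq> 0" "2 * norm b \<le> cmod w" "cmod w > 0"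
    using z by (auto simp: w_def b_def)
  have "z \<notin> jspectrum a"
  proof
    assume "z \<in> jspectrum a"
    then have "cmod (z - 1) \<le> norm (a - 1)"
      using jspectrum_subset_cball[of a] by (auto simp: dist_norm norm_minus_commute)
    then show False using w(2,3) unfolding w_def b_def by linarith
  qed
  then have "is_jinverse (z *\<^sub>C 1 - a) e"
    unfolding e_def by (rule is_jinverse_resolvent)
  then have "(w *\<^sub>C 1 - b) \<odot> e = 1"
    by (simp add: is_jinverse_def w_def b_def scaleC.diff_left scaleC_one)
  then have "w *\<^sub>C e = 1 + b \<odot> e"
    by (simp add: jprod_linear_simps jprod_scaleC_left jprod_one_left algebra_simps)
  then have "(1/w) *\<^sub>C w *\<^sub>C e = (1/w) *\<^sub>C (1 + b \<odot> e)"
    by simp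
  then have e: "e = (1/w) *\<^sub>C (1 + b \<odot> e)"
    using w by (simp add: scaleC_scaleC scaleC_one)
  have be: "norm (b \<odot> e) \<le> norm b * norm e"
    by (rule norm_jprod_le)
  have "norm e = norm (1 + b \<odot> e) / cmod w"
    by (subst e) (simp add: norm_scaleC norm_divide)
  then have "cmod w * norm e \<le> norm (1::'a) + norm b * norm e"
    using norm_triangle_ineq[of 1 "b \<odot> e"] be w by (simp add: field_simps)
  moreover have "2 * norm b * norm e \<le> cmod w * norm e"
    using w by (intro mult_right_mono) auto
  ultimately have "cmod w * norm e \<le> 2 * norm (1::'a)"
    by linarith
  then show bound: "norm (resolvent a z) \<le> 2 * norm (1::'a) / cmod (z - 1)"
    using w(3) by (simp add: e_def w_def field_simps)
  have "e = (1/w) *\<^sub>C 1 + (1/w) *\<^sub>C (b \<odot> e)"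
    by (subst e) (rule scaleC_add_right)
  also have "b \<odot> e = (1/w) *\<^sub>C (b + b \<odot> (b \<odot> e))"
    by (subst e) (simp add: jprod_scaleC_right jprod.add_right jprod_one_right)
  finally have "e = (1/w) *\<^sub>C 1 + ((1/w\<^sup>2) *\<^sub>C b + (1/w\<^sup>2) *\<^sub>C (b \<odot> (b \<odot> e)))"
    by (simp add: scaleC_scaleC scaleC_add_right power2_eq_square)
  moreover have "x - p - q = s" if "x = p + (q + s)" for x p q s :: 'a
    using that by simp
  ultimately have "e - (1/w) *\<^sub>C 1 - (1/w\<^sup>2) *\<^sub>C b = (1/w\<^sup>2) *\<^sub>C (b \<odot> (b \<odot> e))"
    by blast
  moreover have "norm ((1/w\<^sup>2) *\<^sub>C (b \<odot> (b \<odot> e))) \<le> (1 / cmod w ^ 2) * (norm b * (norm b * (2 * norm (1::'a) / cmod w)))"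
  proof -
    have "norm (b \<odot> (b \<odot> e)) \<le> norm b * norm (b \<odot> e)"
      by (rule norm_jprod_le)
    also have "\<dots> \<le> norm b * (norm b * norm e)"
      by (intro mult_left_mono be) simp
    also have "\<dots> \<le> norm b * (norm b * (2 * norm (1::'a) / cmod w))"
      using bound by (intro mult_left_mono) (auto simp: e_def w_def)
    finally show ?thesis
      unfolding norm_scaleC by (intro mult_mono) (auto simp: norm_divide norm_power)
  qed
  ultimately have "norm (e - (1/w) *\<^sub>C 1 - (1/w\<^sup>2) *\<^sub>C b) \<le> (1 / cmod w ^ 2) * (norm b * (norm b * (2 * norm (1::'a) / cmod w)))"
    by simp
  also have "\<dots> = 2 * norm (1::'a) * (norm b)\<^sup>2 / cmod w ^ 3"
    by (simp add: power2_eq_square power3_eq_cube)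
  finally show "norm (resolvent a z - (1 / (z - 1)) *\<^sub>C 1 - (1 / (z - 1)\<^sup>2) *\<^sub>C (a - 1))
       \<le> 2 * norm (1::'a) * (norm (a - 1))\<^sup>2 / cmod (z - 1) ^ 3"
    by (simp add: e_def w_def b_def)
qed

text \<open>Otherwise every functional of the resolvent is entire and tends to 0 at infinity, so
  Liouville's theorem gives a zero resolvent. A spectral point is needed later as one that every
  admissible contour encircles.\<close>

lemma jspectrum_nonempty:
  fixes a :: "'a::unital_jordan_banach_algebra"
  assumes "(1::'a) \<noteq> 0"
  shows "jspectrum a \<noteq> {}"
proof
  assume empty: "jspectrum a = {}"
  have "\<phi> (resolvent a 0) = \<phi> 0" if \<phi>: "cfunctional \<phi>" for \<phi>
  proof -
    have "(\<lambda>z. \<phi> (resolvent a z)) holomorphic_on UNIV"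
      using holomorphic_on_cfunctional_resolvent[OF \<phi>, of a] empty by simp
    moreover have "((\<lambda>z. \<phi> (resolvent a z)) \<longlongrightarrow> 0) at_infinity"
    proof (rule Lim_null_comparison)
      show "\<forall>\<^sub>F z in at_infinity. norm (\<phi> (resolvent a z)) \<le> 2 * norm (1::'a) / cmod (z - 1)"
        unfolding eventually_at_infinity
      proof (intro exI allI impI)
        fix z :: complex assume "2 * norm (a - 1) + 2 \<le> norm z"
        then have "2 * norm (a - 1) \<le> cmod (z - 1)" "z \<noteq> 1"
          using norm_triangle_ineq2[of z 1] norm_ge_zero[of "a - 1"] by (auto simp del: norm_ge_zero)
        then show "norm (\<phi> (resolvent a z)) \<le> 2 * norm (1::'a) / cmod (z - 1)"
          using resolvent_bounds(1) cfunctional_norm_le[OF \<phi>] order_trans by blast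
      qed
      have "filterlim (\<lambda>z::complex. z - 1) at_infinity at_infinity"
        using tendsto_add_filterlim_at_infinity'[OF filterlim_ident tendsto_const, of "-1::complex"] by simp
      then have "((\<lambda>z::complex. inverse (z - 1)) \<longlongrightarrow> 0) at_infinity"
        by (rule filterlim_compose[OF tendsto_inverse_0])
      then have "((\<lambda>z::complex. 2 * norm (1::'a) * cmod (inverse (z - 1))) \<longlongrightarrow> 2 * norm (1::'a) * 0) at_infinity"
        by (intro tendsto_mult tendsto_const tendsto_norm_zero)
      then show "((\<lambda>z. 2 * norm (1::'a) / cmod (z - 1)) \<longlongrightarrow> 0) at_infinity"
        by (simp add: norm_inverse divide_inverse)
    qed
    ultimately have "\<phi> (resolvent a 0) = 0"
      by (rule Liouville_weak_0)
    then show ?thesis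
      using cfunctional_scaleC[OF \<phi>, of 0 0] by simp
  qed
  then have "resolvent a 0 = 0"
    by (rule eq_cfunctionalI)
  then show False
    using is_jinverse_resolvent[of 0 a] empty assms by (simp add: is_jinverse_def jprod_linear_simps)
qed

section \<open>Contour integrals of weakly holomorphic functions\<close>

text \<open>The functionals give access to scalar Cauchy theory; continuity in norm makes the
  vector-valued line integrals exist and the estimates uniform over the functionals.\<close>

definition weakly_holomorphic_on :: "(complex \<Rightarrow> 'a::complex_banach) \<Rightarrow> complex set \<Rightarrow> bool" where
  "weakly_holomorphic_on F S \<longleftrightarrow>
     continuous_on S F \<and> (\<forall>\<phi>. cfunctional \<phi> \<longrightarrow> (\<lambda>z. \<phi> (F z)) holomorphic_on S)"

lemma weakly_holomorphic_on_subset: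
  "weakly_holomorphic_on F S \<Longrightarrow> T \<subseteq> S \<Longrightarrow> weakly_holomorphic_on F T"
  unfolding weakly_holomorphic_on_def by (meson continuous_on_subset holomorphic_on_subset)

definition vcontour_integrable :: "(complex \<Rightarrow> 'a::complex_banach) \<Rightarrow> (real \<Rightarrow> complex) \<Rightarrow> bool" where
  "vcontour_integrable F g \<longleftrightarrow>
     (\<lambda>t. vector_derivative g (at t within {0..1}) *\<^sub>C F (g t)) integrable_on {0..1}"

lemma cfunctional_vcontour_integral:
  assumes \<phi>: "cfunctional \<phi>" and F: "vcontour_integrable F g"
  shows "((\<lambda>z. \<phi> (F z)) has_contour_integral \<phi> (vcontour_integral g F)) g"
proof -
  have "((\<phi> \<circ> (\<lambda>t. vector_derivative g (at t within {0..1}) *\<^sub>C F (g t))) has_integral \<phi> (vcontour_integral g F)) {0..1}"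
    using F unfolding vcontour_integrable_def vcontour_integral_def
    by (intro has_integral_linear cfunctional_bounded_linear[OF \<phi>]) (rule integrable_integral)
  then show ?thesis
    by (simp add: has_contour_integral_def o_def cfunctional_scaleC[OF \<phi>] mult.commute)
qed

lemma vcontour_integrable_linepath:
  assumes "continuous_on (closed_segment a b) F"
  shows "vcontour_integrable F (linepath a b)"
proof -
  have "continuous_on {0..1} (\<lambda>t. F (linepath a b t))"
    by (rule continuous_on_compose2[OF assms continuous_on_linepath])
       (auto simp: linepath_image_01[symmetric] path_image_def)
  then have "continuous_on {0..1} (\<lambda>t. (b - a) *\<^sub>C F (linepath a b t))"
    by (intro scaleC.continuous_on continuous_on_const)
  then have "(\<lambda>t. (b - a) *\<^sub>C F (linepath a b t)) integrable_on {0..1}"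
    by (rule integrable_continuous_real)
  then show ?thesis
    unfolding vcontour_integrable_def
    by (rule integrable_eq) (simp add: vector_derivative_linepath_within)
qed

text \<open>Cauchy's theorem for \<open>\<phi> \<circ> F\<close> makes the line integral of \<open>F\<close> from the centre a primitive.\<close>

lemma weakly_holomorphic_on_ball_primitive:
  fixes F :: "complex \<Rightarrow> 'a::complex_banach"
  assumes F: "weakly_holomorphic_on F (ball z0 r)"
  shows "\<exists>H. \<forall>z\<in>ball z0 r. (H has_derivative (\<lambda>h. h *\<^sub>C F z)) (at z)"
proof (intro exI ballI)
  let ?B = "ball z0 r"
  define H where "H z = vcontour_integral (linepath z0 z) F" for z
  have contF: "continuous_on ?B F"
    using F by (simp add: weakly_holomorphic_on_def)
  fix z assume z: "z \<in> ?B"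
  then have "r > 0"
    by (metis ball_eq_empty empty_iff not_le)
  then have z0: "z0 \<in> ?B" by simp
  have seg: "closed_segment u v \<subseteq> ?B" if "u \<in> ?B" "v \<in> ?B" for u v
    using that convex_ball convex_contains_segment by blast
  show "(H has_derivative (\<lambda>h. h *\<^sub>C F z)) (at z)"
    unfolding has_derivative_at_alt
  proof (intro conjI allI impI)
    show "bounded_linear (\<lambda>h. h *\<^sub>C F z)"
      by (rule scaleC.bounded_linear_left)
    fix e :: real assume "e > 0"
    \<comment> \<open>The radius \<open>d\<close> comes from norm continuity, before any functional
      is fixed; the scalar primitive \<open>G\<close> depends on the functional, \<open>H\<close>
      does not.\<close>
    have "isCont F z"
      using contF z by (simp add: continuous_on_eq_continuous_at)
    then obtain d where d: "d > 0" "\<And>u. dist u z < d \<Longrightarrow> dist (F u) (F z) < e"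
      using \<open>e > 0\<close> unfolding continuous_at_eps_delta by blast
    obtain d' where d': "d' > 0" "ball z d' \<subseteq> ?B"
      using z by (meson open_ball open_contains_ball)
    have "norm (H w - H z - (w - z) *\<^sub>C F z) \<le> e * norm (w - z)" if w: "norm (w - z) < min d d'" for w
    proof (rule norm_le_cfunctionalI)
      fix \<phi> :: "'a \<Rightarrow> complex" assume \<phi>: "cfunctional \<phi>"
      have "w \<in> ball z d'"
        using w by (simp add: dist_norm norm_minus_commute)
      then have wB: "w \<in> ?B"
        using d'(2) by blast
      have "(\<lambda>z. \<phi> (F z)) holomorphic_on ?B"
        using F \<phi> by (simp add: weakly_holomorphic_on_def)
      then obtain G where G: "\<And>u. u \<in> ?B \<Longrightarrow> (G has_field_derivative \<phi> (F u)) (at u within ?B)"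
        using holomorphic_convex_primitive'[of ?B] by auto
      have \<phi>H: "\<phi> (H u) = G u - G z0" if u: "u \<in> ?B" for u
      proof -
        have "vcontour_integrable F (linepath z0 u)"
          using contF seg[OF z0 u] by (intro vcontour_integrable_linepath) (rule continuous_on_subset)
        then have "((\<lambda>z. \<phi> (F z)) has_contour_integral \<phi> (H u)) (linepath z0 u)"
          unfolding H_def by (rule cfunctional_vcontour_integral[OF \<phi>])
        moreover have "((\<lambda>z. \<phi> (F z)) has_contour_integral G u - G z0) (linepath z0 u)"
          using contour_integral_primitive[OF G, where g = "linepath z0 u"] seg[OF z0 u] by simp
        ultimately show ?thesis
          by (rule has_contour_integral_unique)
      qed
      have "((\<lambda>u. \<phi> (F u) - \<phi> (F z)) has_contour_integral
          (G w - \<phi> (F z) * w) - (G z - \<phi> (F z) * z)) (linepath z w)"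
      proof -
        have "((\<lambda>u. G u - \<phi> (F z) * u) has_field_derivative \<phi> (F u) - \<phi> (F z)) (at u within ?B)"
          if "u \<in> ?B" for u
          by (rule derivative_eq_intros G[OF that] refl | simp)+
        then show ?thesis
          using contour_integral_primitive[where g = "linepath z w" and S = ?B
              and f = "\<lambda>u. G u - \<phi> (F z) * u" and f' = "\<lambda>u. \<phi> (F u) - \<phi> (F z)"] seg[OF z wB] by simp
      qed
      then have "norm ((G w - \<phi> (F z) * w) - (G z - \<phi> (F z) * z)) \<le> e * norm (w - z)"
      proof (rule has_contour_integral_bound_linepath)
        fix u assume "u \<in> closed_segment z w"
        then have "dist u z < d"
          using w segment_bound(1)[of u z w] by (simp add: dist_norm)
        then have "norm (F u - F z) < e"
          using d(2) by (simp add: dist_norm)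
        then show "norm (\<phi> (F u) - \<phi> (F z)) \<le> e"
          using cfunctional_norm_le[OF \<phi>, of "F u - F z"] by (simp add: cfunctional_diff[OF \<phi>])
      qed (use \<open>e > 0\<close> in simp)
      moreover have "\<phi> (H w - H z - (w - z) *\<^sub>C F z) = (G w - \<phi> (F z) * w) - (G z - \<phi> (F z) * z)"
        unfolding cfunctional_diff[OF \<phi>] cfunctional_scaleC[OF \<phi>] \<phi>H[OF z] \<phi>H[OF wB]
        by (simp add: algebra_simps)
      ultimately show "cmod (\<phi> (H w - H z - (w - z) *\<^sub>C F z)) \<le> e * norm (w - z)"
        by simp
    qed
    then show "\<exists>d>0. \<forall>w. norm (w - z) < d \<longrightarrow> norm (H w - H z - (w - z) *\<^sub>C F z) \<le> e * norm (w - z)"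
      using d(1) d'(1) by (intro exI[of _ "min d d'"]) auto
  qed
qed

text \<open>While the path stays in a small ball, the integrand is the derivative of
  \<open>H \<circ> g\<close> outside finitely many corners, so the fundamental theorem of calculus
  yields local integrability.\<close>

lemma vcontour_integrable_weakly_holomorphic:
  fixes F :: "complex \<Rightarrow> 'a::complex_banach"
  assumes F: "weakly_holomorphic_on F S" and "open S" and g: "valid_path g" "path_image g \<subseteq> S"
  shows "vcontour_integrable F g"
proof -
  let ?f = "\<lambda>t. vector_derivative g (at t within {0..1}) *\<^sub>C F (g t)"
  have contg: "continuous_on {0..1} g"
    using valid_path_imp_path[OF g(1)] by (simp add: path_def)
  obtain K where K: "finite K" "\<And>t. t \<in> {0..1} - K \<Longrightarrow> g differentiable (at t)"
    using g(1) unfolding valid_path_def piecewise_C1_differentiable_on_def C1_differentiable_on_eq by blast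
  have "?f integrable_on cbox 0 1"
  proof (rule integrable_on_little_subintervals, rule ballI)
    fix x :: real assume "x \<in> cbox 0 1"
    then have x: "x \<in> {0..1}" by simp
    then have "g x \<in> S"
      using g(2) by (auto simp: path_image_def)
    then obtain r where r: "r > 0" "ball (g x) r \<subseteq> S"
      using \<open>open S\<close> open_contains_ball by blast
    then obtain H where H: "\<And>z. z \<in> ball (g x) r \<Longrightarrow> (H has_derivative (\<lambda>h. h *\<^sub>C F z)) (at z)"
      using weakly_holomorphic_on_ball_primitive weakly_holomorphic_on_subset[OF F] by metis
    obtain d where d: "d > 0" "\<And>t. t \<in> {0..1} \<Longrightarrow> dist t x < d \<Longrightarrow> dist (g t) (g x) < r"
      using contg x r(1) unfolding continuous_on_iff by blast
    have "?f integrable_on {u..v}" if sub: "{u..v} \<subseteq> ball x d" "{u..v} \<subseteq> {0..1}" and "u \<le> v" for u v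
    proof -
      have gB: "g t \<in> ball (g x) r" if "t \<in> {u..v}" for t
      proof -
        have "t \<in> {0..1}" "dist t x < d"
          using that sub by (auto simp: dist_commute)
        then show ?thesis
          using d(2) by (simp add: dist_commute)
      qed
      have "(?f has_integral (H \<circ> g) v - (H \<circ> g) u) {u..v}"
      proof (rule fundamental_theorem_of_calculus_interior_strong[OF K(1) \<open>u \<le> v\<close>])
        fix t assume t: "t \<in> {u<..<v} - K"
        then have t01: "t \<in> {0..1}" and tuv: "t \<in> {u..v}"
          using sub by auto
        have g': "(g has_vector_derivative vector_derivative g (at t)) (at t)"
          using K(2)[of t] t01 t vector_derivative_works by blast
        have "vector_derivative g (at t within {0..1}) = vector_derivative g (at t)"
          using vector_derivative_at_within_ivl[OF g'] t01 by simp
        moreover have "((H \<circ> g) has_vector_derivative vector_derivative g (at t) *\<^sub>C F (g t)) (at t)"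
          using vector_derivative_diff_chain_within[OF g' has_derivative_at_withinI[OF H[OF gB[OF tuv]]]] .
        ultimately show "((H \<circ> g) has_vector_derivative ?f t) (at t)"
          by simp
      next
        have "continuous_on (ball (g x) r) H"
          using H by (meson continuous_at_imp_continuous_on has_derivative_continuous)
        then show "continuous_on {u..v} (H \<circ> g)"
          using gB by (intro continuous_on_compose continuous_on_subset[OF contg sub(2)])
            (auto intro: continuous_on_subset)
      qed
      then show ?thesis by blast
    qed
    then show "\<exists>d>0. \<forall>u v. x \<in> cbox u v \<and> cbox u v \<subseteq> ball x d \<and> cbox u v \<subseteq> cbox 0 1 \<longrightarrow> ?f integrable_on cbox u v"
      using d(1) by (intro exI[of _ d]) auto
  qed
  then show ?thesis
    by (simp add: vcontour_integrable_def)
qed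

section \<open>Winding numbers and deformation of contours\<close>

lemma winding_number_zero_unbounded_connected:
  assumes g: "path g" "pathfinish g = pathstart g"
    and T: "connected T" "\<not> bounded T" "T \<inter> path_image g = {}" and w: "w \<in> T"
  shows "winding_number g w = 0"
proof -
  obtain B where B: "\<And>z. B \<le> norm z \<Longrightarrow> winding_number g z = 0"
    using winding_number_zero_at_infinity[OF g] by blast
  obtain z where "z \<in> T" "B \<le> norm z"
    using T(2) unfolding bounded_iff by (meson linear)
  then show ?thesis
    using winding_number_eq[OF g w _ T(1,3)] B by metis
qed

text \<open>Cauchy's theorem is applied to one closed path \<open>L\<close>: both loops, restarted
  at \<open>p\<close> and \<open>q\<close>, the second reversed, joined by a bridge run in both
  directions. The bridge cancels in the integral and in the winding numbers.\<close>

lemma contour_integral_eq_same_winding: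
  assumes S: "open S" and h: "h holomorphic_on S"
    and g: "valid_path g" "pathfinish g = pathstart g" "path_image g \<subseteq> S"
    and k: "valid_path k" "pathfinish k = pathstart k" "path_image k \<subseteq> S"
    and pq: "p \<in> path_image g" "q \<in> path_image k" "closed_segment p q \<subseteq> S"
    and wind: "\<And>w. w \<notin> S \<Longrightarrow> winding_number g w = winding_number k w"
  shows "contour_integral g h = contour_integral k h"
proof -
  obtain a b where ab: "a \<in> {0..1}" "g a = p" "b \<in> {0..1}" "k b = q"
    using pq by (auto simp: path_image_def)
  define g' k' where "g' = shiftpath a g" and "k' = shiftpath b k"
  have g': "valid_path g'" "pathstart g' = p" "pathfinish g' = p" "path_image g' = path_image g"
    and k': "valid_path k'" "pathstart k' = q" "pathfinish k' = q" "path_image k' = path_image k"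
    using ab g k by (auto simp: g'_def k'_def pathstart_shiftpath pathfinish_shiftpath path_image_shiftpath)
  define L where "L = g' +++ linepath p q +++ reversepath k' +++ linepath q p"
  have seg: "path_image (linepath p q) \<subseteq> S" "path_image (linepath q p) \<subseteq> S"
    using pq(3) by (auto simp: closed_segment_commute)
  have L: "valid_path L" "pathfinish L = pathstart L" "path_image L \<subseteq> S"
    using g' k' g(3) k(3) seg by (auto simp: L_def path_image_join intro!: valid_path_join)
  have int: "h contour_integrable_on \<gamma>" if "valid_path \<gamma>" "path_image \<gamma> \<subseteq> S" for \<gamma>
    using that h S by (rule_tac contour_integrable_holomorphic_simple)
  have ints: "h contour_integrable_on g'" "h contour_integrable_on reversepath k'"
     "h contour_integrable_on linepath p q" "h contour_integrable_on linepath q p"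
    using g' k' g(3) k(3) seg by (auto intro!: int)
  have "winding_number L w = 0" if w: "w \<notin> S" for w
  proof -
    have notin: "w \<notin> path_image g'" "w \<notin> path_image k'" "w \<notin> closed_segment p q" "w \<notin> closed_segment q p"
      using w g' k' g(3) k(3) pq(3) by (auto simp: closed_segment_commute)
    have "winding_number (linepath q p) w = - winding_number (linepath p q) w"
      using winding_number_reversepath[of "linepath p q" w] notin by simp
    then have "winding_number L w = winding_number g' w - winding_number k' w"
      using g' k' notin
      by (simp add: L_def winding_number_join winding_number_reversepath path_image_join
          valid_path_imp_path)
    also have "\<dots> = winding_number g w - winding_number k w"
      using notin g' k' g k ab
      by (simp add: g'_def k'_def winding_number_shiftpath valid_path_imp_path path_image_shiftpath)
    finally show ?thesis
      using wind[OF w] by simp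
  qed
  then have "contour_integral L h = 0"
    using Cauchy_theorem_global[OF S h L] contour_integral_unique by blast
  moreover have "contour_integral L h = contour_integral g' h - contour_integral k' h"
    using g' k' ints contour_integral_reversepath[of "linepath p q" h] contour_integral_reversepath[of k' h]
    by (simp add: L_def valid_path_join contour_integrable_joinI)
  ultimately show ?thesis
    using g k ab by (simp add: g'_def k'_def contour_integral_shiftpath)
qed

section \<open>The logarithm near the unit\<close>

lemma weakly_holomorphic_on_Ln_resolvent:
  "weakly_holomorphic_on (\<lambda>z. Ln z *\<^sub>C resolvent a z) (- \<real>\<^sub>\<le>\<^sub>0 - jspectrum a)"
  unfolding weakly_holomorphic_on_def
proof (intro conjI allI impI)
  show "continuous_on (- \<real>\<^sub>\<le>\<^sub>0 - jspectrum a) (\<lambda>z. Ln z *\<^sub>C resolvent a z)"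
    by (intro scaleC.continuous_on continuous_on_Ln continuous_on_id continuous_on_subset[OF continuous_on_resolvent]) auto
  fix \<phi> :: "'a \<Rightarrow> complex" assume \<phi>: "cfunctional \<phi>"
  show "(\<lambda>z. \<phi> (Ln z *\<^sub>C resolvent a z)) holomorphic_on (- \<real>\<^sub>\<le>\<^sub>0 - jspectrum a)"
    unfolding cfunctional_scaleC[OF \<phi>]
    by (intro holomorphic_intros holomorphic_on_subset[OF holomorphic_on_cfunctional_resolvent[OF \<phi>]]) auto
qed

lemma open_slit_minus_jspectrum: "open (- \<real>\<^sub>\<le>\<^sub>0 - jspectrum a)"
proof -
  have "open (- \<real>\<^sub>\<le>\<^sub>0 \<inter> - jspectrum a)"
    by (intro open_Int open_Compl_jspectrum) (simp add: open_Compl)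
  then show ?thesis
    by (simp add: Diff_eq)
qed

text \<open>The conclusion is existential because the contour inside \<open>jlog\<close> is an
  unspecified choice; whatever follows has to hold for every admissible contour.\<close>

lemma cfunctional_jlog:
  fixes a :: "'a::unital_jordan_banach_algebra"
  assumes \<phi>: "cfunctional \<phi>" and ex: "\<exists>g. log_contour a g"
  shows "\<exists>g. log_contour a g \<and>
     \<phi> (jlog a) = contour_integral g (\<lambda>z. Ln z * \<phi> (resolvent a z)) / (2 * of_real pi * \<i>)"
proof -
  define g where "g = (SOME g. log_contour a g)"
  have g: "log_contour a g"
    unfolding g_def using ex by (rule someI_ex)
  have "vcontour_integrable (\<lambda>z. Ln z *\<^sub>C resolvent a z) g"
    using g weakly_holomorphic_on_Ln_resolvent open_slit_minus_jspectrum
    by (intro vcontour_integrable_weakly_holomorphic) (auto simp: log_contour_def)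
  from contour_integral_unique[OF cfunctional_vcontour_integral[OF \<phi> this]]
  have "\<phi> (vcontour_integral g (\<lambda>z. Ln z *\<^sub>C resolvent a z)) = contour_integral g (\<lambda>z. Ln z * \<phi> (resolvent a z))"
    by (simp add: cfunctional_scaleC[OF \<phi>])
  moreover have "jlog a = (1 / (2 * of_real pi * \<i>)) *\<^sub>C vcontour_integral g (\<lambda>z. Ln z *\<^sub>C resolvent a z)"
    by (simp add: jlog_def g_def resolvent_def)
  ultimately show ?thesis
    using g by (auto simp: cfunctional_scaleC[OF \<phi>])
qed

lemma unbounded_ray:
  assumes "cmod u = 1"
  shows "connected ((\<lambda>t. s + of_real t * u) ` {0..})" "\<not> bounded ((\<lambda>t. s + of_real t * u) ` {0..})"
proof -
  show "connected ((\<lambda>t. s + of_real t * u) ` {0..})"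
    by (intro connected_continuous_image continuous_intros connected_Ici)
  show "\<not> bounded ((\<lambda>t. s + of_real t * u) ` {0..})"
  proof
    assume "bounded ((\<lambda>t. s + of_real t * u) ` {0..})"
    then obtain B where B: "\<And>t. t \<ge> 0 \<Longrightarrow> cmod (s + of_real t * u) \<le> B"
      unfolding bounded_iff by auto
    define t where "t = \<bar>B\<bar> + cmod s + 1"
    have "t \<ge> 0"
      by (simp add: t_def)
    then have "t = cmod (of_real t * u)"
      using assms by (simp add: norm_mult)
    also have "\<dots> \<le> cmod (s + of_real t * u) + cmod s"
      using norm_triangle_ineq4[of "s + of_real t * u" s] by simp
    also have "\<dots> \<le> B + cmod s"
      using B[OF \<open>t \<ge> 0\<close>] by simp
    finally show False
      by (simp add: t_def)
  qed
qed

lemma winding_number_slit: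
  assumes "path g" "pathfinish g = pathstart g" "path_image g \<subseteq> - \<real>\<^sub>\<le>\<^sub>0" "w \<in> \<real>\<^sub>\<le>\<^sub>0"
  shows "winding_number g w = 0"
proof -
  have eq: "\<real>\<^sub>\<le>\<^sub>0 = (\<lambda>t. 0 + of_real t * (-1::complex)) ` {0..}"
  proof (intro set_eqI iffI)
    fix z :: complex assume "z \<in> \<real>\<^sub>\<le>\<^sub>0"
    then show "z \<in> (\<lambda>t. 0 + of_real t * (-1::complex)) ` {0..}"
      by (intro image_eqI[of _ _ "- Re z"]) (auto simp: complex_nonpos_Reals_iff complex_eq_iff)
  qed (auto simp: complex_nonpos_Reals_iff)
  show ?thesis
    using assms(3,4) unbounded_ray[of "-1" 0]
    by (intro winding_number_zero_unbounded_connected[OF assms(1,2), of "\<real>\<^sub>\<le>\<^sub>0"]) (auto simp: eq)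
qed

lemma slit_disjoint_ball: "z \<in> \<real>\<^sub>\<le>\<^sub>0 \<Longrightarrow> 1 \<le> cmod (z - 1)"
  using abs_Re_le_cmod[of "z - 1"] by (simp add: complex_nonpos_Reals_iff)

lemma circle_in_slit_minus_jspectrum:
  assumes a: "norm (a - 1) < \<rho>" "\<rho> < 1"
  shows "path_image (circlepath 1 \<rho>) \<subseteq> - \<real>\<^sub>\<le>\<^sub>0 - jspectrum a"
proof
  fix z assume "z \<in> path_image (circlepath 1 \<rho>)"
  then have z: "cmod (z - 1) = \<rho>"
    using a(1) norm_ge_zero[of "a - 1"] by (auto simp: dist_norm norm_minus_commute simp del: norm_ge_zero)
  have "z \<notin> jspectrum a"
    using jspectrum_subset_cball[of a] z a by (auto simp: dist_norm norm_minus_commute)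
  then show "z \<in> - \<real>\<^sub>\<le>\<^sub>0 - jspectrum a"
    using slit_disjoint_ball[of z] z a by auto
qed

lemma winding_number_circle_jspectrum:
  assumes "norm (a - 1) < \<rho>" "z \<in> jspectrum a"
  shows "winding_number (circlepath 1 \<rho>) z = 1"
  using jspectrum_subset_cball[of a] assms
  by (intro winding_number_circlepath) (auto simp: dist_norm norm_minus_commute)

lemma log_contour_circlepath:
  assumes "norm (a - 1) < \<rho>" "\<rho> < 1"
  shows "log_contour a (circlepath 1 \<rho>)"
  using circle_in_slit_minus_jspectrum[OF assms] winding_number_circle_jspectrum[OF assms(1)]
  by (simp add: log_contour_def)

text \<open>A contour in the slit plane around the spectrum may pass inside the disc, but the ray to the
  right of the rightmost spectral point meets it, and the half plane beyond that point is free of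
  spectrum. So the contour can be joined to the circle off the spectrum.\<close>

lemma contour_integral_log_contour_eq_circle:
  fixes a :: "'a::unital_jordan_banach_algebra"
  assumes ne: "jspectrum a \<noteq> {}" and a: "norm (a - 1) < \<rho>" "\<rho> < 1" and g: "log_contour a g"
    and h: "h holomorphic_on (- \<real>\<^sub>\<le>\<^sub>0 - jspectrum a)"
  shows "contour_integral g h = contour_integral (circlepath 1 \<rho>) h"
proof -
  have gv: "valid_path g" "pathfinish g = pathstart g" "path_image g \<subseteq> - \<real>\<^sub>\<le>\<^sub>0 - jspectrum a"
    "\<And>z. z \<in> jspectrum a \<Longrightarrow> winding_number g z = 1"
    using g by (auto simp: log_contour_def)
  obtain s where s: "s \<in> jspectrum a" "\<And>z. z \<in> jspectrum a \<Longrightarrow> Re z \<le> Re s"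
    using continuous_attains_sup[OF compact_jspectrum ne, of Re] continuous_on_Re[OF continuous_on_id] by auto
  have s1: "cmod (s - 1) < \<rho>"
    using s(1) jspectrum_subset_cball[of a] a by (auto simp: dist_norm norm_minus_commute)
  then have Re_s: "0 < Re s" "Re s < 1 + \<rho>"
    using abs_Re_le_cmod[of "s - 1"] a(2) by auto
  have "\<exists>p \<in> path_image g. p \<in> (\<lambda>t. s + of_real t * 1) ` {0..}"
  proof (rule ccontr)
    assume "\<not> ?thesis"
    then have "winding_number g s = 0"
      using unbounded_ray[of 1 s] gv
      by (intro winding_number_zero_unbounded_connected[where T = "(\<lambda>t. s + of_real t * 1) ` {0..}"])
         (auto simp: valid_path_imp_path image_iff intro!: bexI[of _ 0])
    then show False
      using gv(4)[OF s(1)] by simp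
  qed
  then obtain t where t: "t \<ge> 0" "s + of_real t \<in> path_image g"
    by auto
  \<comment> \<open>The contour avoids the spectrum, so it meets the ray strictly to the right of
    \<open>s\<close>.\<close>
  moreover have "t \<noteq> 0"
    using t gv(3) s(1) by auto
  ultimately have p: "Re s < Re (s + of_real t)"
    by simp
  have half: "z \<in> - \<real>\<^sub>\<le>\<^sub>0 - jspectrum a" if "Re s < Re z" for z
    using that s(2)[of z] Re_s by (auto simp: complex_nonpos_Reals_iff)
  have \<rho>: "\<rho> > 0"
    using a(1) norm_ge_zero order_le_less_trans by blast
  show ?thesis
  proof (rule contour_integral_eq_same_winding[OF open_slit_minus_jspectrum h gv(1-3) _ _ _ t(2)])
    show "path_image (circlepath 1 \<rho>) \<subseteq> - \<real>\<^sub>\<le>\<^sub>0 - jspectrum a"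
      by (rule circle_in_slit_minus_jspectrum[OF a])
    show "of_real (1 + \<rho>) \<in> path_image (circlepath 1 \<rho>)"
      using \<rho> by (simp add: dist_norm)
    have "closed_segment (s + of_real t) (of_real (1 + \<rho>)) \<subseteq> {z. Re s < Re z}"
      using p Re_s by (intro closed_segment_subset convex_halfspace_Re_gt) auto
    then show "closed_segment (s + of_real t) (of_real (1 + \<rho>)) \<subseteq> - \<real>\<^sub>\<le>\<^sub>0 - jspectrum a"
      using half by blast
    fix w assume "w \<notin> - \<real>\<^sub>\<le>\<^sub>0 - jspectrum a"
    then consider "w \<in> \<real>\<^sub>\<le>\<^sub>0" | "w \<in> jspectrum a" by blast
    then show "winding_number g w = winding_number (circlepath 1 \<rho>) w"
    proof cases
      case 1
      then have "winding_number g w = 0" "winding_number (circlepath 1 \<rho>) w = 0"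
        using gv circle_in_slit_minus_jspectrum[OF a]
        by (intro winding_number_slit; force simp: valid_path_imp_path)+
      then show ?thesis by simp
    next
      case 2
      then show ?thesis
        using gv(4) winding_number_circle_jspectrum[OF a(1)] by simp
    qed
  qed simp_all
qed

text \<open>On the circle the resolvent is \<open>1/(z - 1) + (a - 1)/(z - 1)\<^sup>2\<close> up to an error of second order
  in \<open>a - 1\<close>; integrating against \<open>Ln\<close>, the two main terms give \<open>Ln 1 = 0\<close> and \<open>Ln' 1 = 1\<close>.\<close>

lemma jlog_estimate:
  "\<exists>K. \<forall>a::'a::unital_jordan_banach_algebra. norm (a - 1) \<le> 1 / 4 \<longrightarrow>
     norm (jlog a - (a - 1)) \<le> K * (norm (a - 1))\<^sup>2"
proof (cases "(1::'a) = 0")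
  \<comment> \<open>In the zero algebra the spectrum is empty and winding numbers tell nothing about
    the contour, but every element is 0.\<close>
  case True
  have "x = 0" for x :: 'a
    using jprod_one_left[of x] by (simp add: True jprod_linear_simps)
  then show ?thesis
    by (intro exI[of _ 0]) simp
next
  case False
  have contLn: "continuous_on (cball 1 (1/2)) Ln"
    by (intro continuous_on_Ln continuous_on_id) (use slit_disjoint_ball in \<open>force simp: dist_norm norm_minus_commute\<close>)
  have holLn: "Ln holomorphic_on ball 1 (1/2)"
    by (intro holomorphic_on_Ln) (use slit_disjoint_ball in \<open>force simp: dist_norm norm_minus_commute\<close>)
  have "bounded (Ln ` cball 1 (1/2))"
    by (intro compact_imp_bounded compact_continuous_image[OF contLn] compact_cball)
  then obtain M where M: "\<And>z. z \<in> cball 1 (1/2) \<Longrightarrow> cmod (Ln z) \<le> M"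
    unfolding bounded_iff by blast
  have "M \<ge> 0"
    using M[of 1] by simp
  have int1: "((\<lambda>z. Ln z / (z - 1)) has_contour_integral 0) (circlepath 1 (1/2))"
    using Cauchy_has_contour_integral_higher_derivative_circlepath[OF contLn holLn, of 1 0] by simp
  have int2: "((\<lambda>z. Ln z / (z - 1)\<^sup>2) has_contour_integral 2 * of_real pi * \<i>) (circlepath 1 (1/2))"
  proof -
    have "deriv Ln 1 = (1::complex)"
      by (rule DERIV_imp_deriv) (use has_field_derivative_Ln[of 1] in simp)
    then show ?thesis
      using Cauchy_has_contour_integral_higher_derivative_circlepath[OF contLn holLn, of 1 1]
      by (simp add: power2_eq_square)
  qed
  \<comment> \<open>On the circle of radius 1/2 the remainder of the resolvent is at most
    \<open>16 * norm 1 * (norm (a - 1))\<^sup>2\<close>; the factor \<open>M\<close> bounds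
    \<open>Ln\<close>, the length is pi, and the Cauchy integral is divided by 2 pi. The bound 1/4
    is half the radius, as \<open>resolvent_bounds\<close> demands.\<close>
  define K where "K = 8 * M * norm (1::'a)"
  have "norm (jlog a - (a - 1)) \<le> K * (norm (a - 1))\<^sup>2" if a: "norm (a - 1) \<le> 1 / 4" for a :: 'a
  proof (rule norm_le_cfunctionalI)
    fix \<phi> :: "'a \<Rightarrow> complex" assume \<phi>: "cfunctional \<phi>"
    let ?C = "circlepath 1 (1/2)"
    define h where "h z = Ln z * \<phi> (resolvent a z)" for z
    have a': "norm (a - 1) < 1 / 2" "(1/2::real) < 1"
      using a by auto
    have S: "path_image ?C \<subseteq> - \<real>\<^sub>\<le>\<^sub>0 - jspectrum a"
      by (rule circle_in_slit_minus_jspectrum[OF a'])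
    have holh: "h holomorphic_on (- \<real>\<^sub>\<le>\<^sub>0 - jspectrum a)"
      using weakly_holomorphic_on_Ln_resolvent[of a] \<phi>
      unfolding weakly_holomorphic_on_def h_def cfunctional_scaleC[OF \<phi>, symmetric] by blast
    \<comment> \<open>The circle proves that an admissible contour exists; the one behind
      \<open>jlog\<close> is moved to it afterwards.\<close>
    obtain g where g: "log_contour a g" "\<phi> (jlog a) = contour_integral g h / (2 * of_real pi * \<i>)"
      using cfunctional_jlog[OF \<phi>] log_contour_circlepath[OF a'] unfolding h_def by blast
    have "h contour_integrable_on ?C"
      using holh open_slit_minus_jspectrum S by (intro contour_integrable_holomorphic_simple) auto
    then have "(h has_contour_integral contour_integral ?C h) ?C"
      by (rule has_contour_integral_integral)
    also have "contour_integral ?C h = 2 * of_real pi * \<i> * \<phi> (jlog a)"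
      using g contour_integral_log_contour_eq_circle[OF jspectrum_nonempty[OF False] a' g(1) holh] by simp
    finally have "((\<lambda>z. h z - Ln z / (z - 1) * \<phi> 1 - Ln z / (z - 1)\<^sup>2 * \<phi> (a - 1)) has_contour_integral
        2 * of_real pi * \<i> * \<phi> (jlog a) - 0 * \<phi> 1 - 2 * of_real pi * \<i> * \<phi> (a - 1)) ?C"
      by (intro has_contour_integral_diff has_contour_integral_rmul int1 int2)
    then have "cmod (2 * of_real pi * \<i> * \<phi> (jlog a) - 0 * \<phi> 1 - 2 * of_real pi * \<i> * \<phi> (a - 1))
        \<le> (M * (16 * norm (1::'a) * (norm (a - 1))\<^sup>2)) * (2 * pi * (1/2))"
    proof (rule has_contour_integral_bound_circlepath)
      fix z :: complex assume z: "cmod (z - 1) = 1 / 2"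
      have "h z - Ln z / (z - 1) * \<phi> 1 - Ln z / (z - 1)\<^sup>2 * \<phi> (a - 1)
          = Ln z * \<phi> (resolvent a z - (1 / (z - 1)) *\<^sub>C 1 - (1 / (z - 1)\<^sup>2) *\<^sub>C (a - 1))"
        unfolding cfunctional_diff[OF \<phi>] cfunctional_scaleC[OF \<phi>] h_def by (simp add: algebra_simps)
      moreover have "cmod (\<phi> (resolvent a z - (1 / (z - 1)) *\<^sub>C 1 - (1 / (z - 1)\<^sup>2) *\<^sub>C (a - 1)))
          \<le> 16 * norm (1::'a) * (norm (a - 1))\<^sup>2"
      proof -
        have "2 * norm (a - 1) \<le> cmod (z - 1)" "z \<noteq> 1"
          using a z by auto
        from order_trans[OF cfunctional_norm_le[OF \<phi>] resolvent_bounds(2)[OF this]]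
        show ?thesis
          by (simp add: z power3_eq_cube)
      qed
      moreover have "cmod (Ln z) \<le> M"
        using M[of z] z by (simp add: dist_norm norm_minus_commute)
      ultimately show "cmod (h z - Ln z / (z - 1) * \<phi> 1 - Ln z / (z - 1)\<^sup>2 * \<phi> (a - 1))
          \<le> M * (16 * norm (1::'a) * (norm (a - 1))\<^sup>2)"
        using \<open>M \<ge> 0\<close> by (simp only: norm_mult) (intro mult_mono; simp)
    qed (use \<open>M \<ge> 0\<close> in auto)
    also have "2 * of_real pi * \<i> * \<phi> (jlog a) - 0 * \<phi> 1 - 2 * of_real pi * \<i> * \<phi> (a - 1)
        = 2 * of_real pi * \<i> * \<phi> (jlog a - (a - 1))"
      unfolding cfunctional_diff[OF \<phi>, of "jlog a"] by (simp add: algebra_simps)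
    finally show "cmod (\<phi> (jlog a - (a - 1))) \<le> K * (norm (a - 1))\<^sup>2"
      by (simp add: norm_mult K_def field_simps)
  qed
  then show ?thesis by blast
qed

section \<open>Continuity of the exponential and the limit\<close>

lemma continuous_on_jpow: "continuous_on A (\<lambda>a. jpow a n)"
  by (induction n) (auto intro!: jprod.continuous_on continuous_on_id)

lemma tendsto_jexp:
  fixes x :: "'a::unital_jordan_banach_algebra"
  assumes "(X \<longlongrightarrow> x) F"
  shows "((\<lambda>n. jexp (X n)) \<longlongrightarrow> jexp x) F"
proof -
  \<comment> \<open>A ball that eventually contains the converging values and on which the
    exponential series converges uniformly.\<close>
  define R where "R = norm x + 1"
  have "uniform_limit (cball 0 R) (\<lambda>n (y::'a). \<Sum>k<n. jpow y k /\<^sub>R fact k) (\<lambda>y. \<Sum>k. jpow y k /\<^sub>R fact k) sequentially"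
  proof (rule Weierstrass_m_test)
    show "summable (\<lambda>k. (inverse (fact k) * R ^ k) * norm (1::'a))"
      by (intro summable_mult2 summable_exp)
    fix k and y :: 'a assume "y \<in> cball 0 R"
    then have "norm y ^ k \<le> R ^ k"
      by (intro power_mono) auto
    then have "norm (jpow y k) \<le> R ^ k * norm (1::'a)"
      using norm_jpow_le[of y k] mult_right_mono norm_ge_zero order_trans by meson
    then show "norm (jpow y k /\<^sub>R fact k) \<le> (inverse (fact k) * R ^ k) * norm (1::'a)"
      by (simp add: mult.assoc mult_left_mono)
  qed
  then have "continuous_on (cball 0 R) (\<lambda>y::'a. \<Sum>k. jpow y k /\<^sub>R fact k)"
    by (rule uniform_limit_theorem[rotated])
       (auto intro!: always_eventually continuous_on_sum continuous_on_scaleR continuous_on_const continuous_on_jpow)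
  then have cont: "continuous_on (cball 0 R) (jexp :: 'a \<Rightarrow> 'a)"
    by (simp add: jexp_def[abs_def])
  have "\<forall>\<^sub>F n in F. dist (X n) x < 1"
    by (rule tendstoD[OF assms]) simp
  then have "\<forall>\<^sub>F n in F. X n \<in> cball 0 R"
  proof eventually_elim
    case (elim n)
    then show ?case
      using norm_triangle_ineq2[of "X n" x] by (simp add: R_def dist_norm)
  qed
  then show ?thesis
    by (intro continuous_on_tendsto_compose[OF cont assms]) (simp_all add: R_def)
qed

lemma has_cderiv_cderiv:
  assumes "vholomorphic_on f S" "z \<in> S"
  shows "has_cderiv f (cderiv f z) z"
proof -
  obtain D where D: "has_cderiv f D z"
    using assms by (auto simp: vholomorphic_on_def)
  moreover have "D' = D" if "has_cderiv f D' z" for D'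
    using that D unfolding has_cderiv_def by (intro tendsto_unique[OF at_neq_bot])
  ultimately have "cderiv f z = D"
    unfolding cderiv_def by (rule the_equality)
  with D show ?thesis by simp
qed

theorem theorem2p1:
  fixes f :: "complex \<Rightarrow> 'a::unital_jordan_banach_algebra"
    and r :: real
    and lam mu :: "nat \<Rightarrow> complex"
    and l :: complex
  assumes "r > 0"
    and "vholomorphic_on f (ball 0 r)"
    and "f 0 = 1"
    and "\<And>n. lam n \<in> ball 0 r"
    and "lam \<longlonglongrightarrow> 0"
    and "(\<lambda>n. lam n * mu n) \<longlonglongrightarrow> l"
  shows "(\<forall>\<^sub>F n in sequentially. jpowr_defined (f (lam n))) \<and>
         (\<lambda>n. jpowr (f (lam n)) (mu n)) \<longlonglongrightarrow> jexp (l *\<^sub>C cderiv f 0)"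
proof
  define D where "D = cderiv f 0"
  \<comment> \<open>The difference quotient is completed at 0, since some \<open>lam n\<close> may
    be 0.\<close>
  define q where "q z = (if z = 0 then D else (1 / z) *\<^sub>C (f z - 1))" for z
  define b where "b n = f (lam n) - 1" for n
  have "has_cderiv f D 0"
    unfolding D_def by (rule has_cderiv_cderiv[OF assms(2)]) (use \<open>r > 0\<close> in simp)
  then have "((\<lambda>z. (1 / z) *\<^sub>C (f z - 1)) \<longlongrightarrow> D) (at 0)"
    by (simp add: has_cderiv_def \<open>f 0 = 1\<close>)
  then have "(q \<longlongrightarrow> D) (at 0)"
    by (rule Lim_transform_eventually) (auto simp: q_def eventually_at intro!: exI[of _ 1])
  moreover have q0: "q 0 = D"
    by (simp add: q_def)
  ultimately have "isCont q 0"
    by (simp add: isCont_def)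
  then have q: "(\<lambda>n. q (lam n)) \<longlonglongrightarrow> D"
    using isCont_tendsto_compose[OF _ assms(5)] q0 by metis
  have b: "b n = lam n *\<^sub>C q (lam n)" for n
    by (simp add: b_def q_def \<open>f 0 = 1\<close> scaleC_scaleC scaleC_one)
  have b0: "b \<longlonglongrightarrow> 0"
    using scaleC.tendsto[OF assms(5) q] by (simp add: b[abs_def])
  have mub: "(\<lambda>n. mu n *\<^sub>C b n) \<longlonglongrightarrow> l *\<^sub>C D"
    using scaleC.tendsto[OF assms(6) q] by (simp add: b scaleC_scaleC mult.commute)
  have small: "\<forall>\<^sub>F n in sequentially. norm (b n) < 1 / 4"
    using tendstoD[OF b0, of "1/4"] by simp
  then show "\<forall>\<^sub>F n in sequentially. jpowr_defined (f (lam n))"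
  proof eventually_elim
    case (elim n)
    then show ?case
      using jspectrum_subset_cball[of "f (lam n)"] slit_disjoint_ball
      unfolding jpowr_defined_def b_def by (force simp: dist_norm norm_minus_commute)
  qed
  obtain K where K: "\<And>a::'a. norm (a - 1) \<le> 1 / 4 \<Longrightarrow> norm (jlog a - (a - 1)) \<le> K * (norm (a - 1))\<^sup>2"
    using jlog_estimate by blast
  \<comment> \<open>The quadratic error times the modulus of \<open>mu n\<close> is a multiple of
    \<open>norm (mu n *\<^sub>C b n) * norm (b n)\<close>: a convergent factor and one that tends to
    0, however fast \<open>mu n\<close> grows.\<close>
  have "(\<lambda>n. mu n *\<^sub>C jlog (f (lam n)) - mu n *\<^sub>C b n) \<longlonglongrightarrow> 0"
  proof (rule Lim_null_comparison)
    show "\<forall>\<^sub>F n in sequentially. norm (mu n *\<^sub>C jlog (f (lam n)) - mu n *\<^sub>C b n) \<le> K * norm (mu n *\<^sub>C b n) * norm (b n)"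
      using small
    proof eventually_elim
      case (elim n)
      have "norm (mu n *\<^sub>C jlog (f (lam n)) - mu n *\<^sub>C b n) = cmod (mu n) * norm (jlog (f (lam n)) - b n)"
        by (simp add: scaleC.diff_right[symmetric] norm_scaleC)
      also have "\<dots> \<le> cmod (mu n) * (K * (norm (b n))\<^sup>2)"
        using K[of "f (lam n)"] elim by (intro mult_left_mono) (simp_all add: b_def)
      finally show ?case
        by (simp add: norm_scaleC power2_eq_square mult_ac)
    qed
    have "(\<lambda>n. K * norm (mu n *\<^sub>C b n) * norm (b n)) \<longlonglongrightarrow> K * norm (l *\<^sub>C D) * norm (0::'a)"
      by (intro tendsto_intros mub b0)
    then show "(\<lambda>n. K * norm (mu n *\<^sub>C b n) * norm (b n)) \<longlonglongrightarrow> 0"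
      by simp
  qed
  then have "(\<lambda>n. mu n *\<^sub>C jlog (f (lam n))) \<longlonglongrightarrow> l *\<^sub>C D"
    using tendsto_add[OF _ mub] by fastforce
  then show "(\<lambda>n. jpowr (f (lam n)) (mu n)) \<longlonglongrightarrow> jexp (l *\<^sub>C cderiv f 0)"
    unfolding jpowr_def D_def by (rule tendsto_jexp)
qed

end
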